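(* Let $\mathbb{K}$ be an algebraically closed field of characteristic zero, $\mathcal{C}\subset\mathbb{K}^2$ an affine irreducible plane curve defined by an irreducible polynomial $f(y_1,y_2)$, $A=(a,b)\in\mathbb{K}^2$, $d\in\mathbb{K}\setminus\{0\}$, and assume $\mathcal{C}_0\neq\emptyset$. Then: (1) all irreducible components of $\mathfrak{B}(\mathcal{C},A,d)$ have dimension $1$; (2) if $\mathcal{C}$ is not the circle centered at $A$ of radius $d$, all irreducible components of $\mathfrak{C}(\mathcal{C},A,d)$ have dimension $1$; (3) if $\mathcal{C}$ is the circle centered at $A$ of radius $d$, then $\mathfrak{C}(\mathcal{C},A,d)$ is the union of $\{A\}$ and the circle centered at $A$ of radius $2d$; (4) $\mathfrak{C}(\mathcal{C},A,d)$ has at most two irreducible components.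
   Context: The circle centered at $(c_1,c_2)$ of radius $r$ is the curve $(x_1-c_1)^2+(x_2-c_2)^2=r^2$. $\mathfrak{B}(\mathcal{C},A,d)\subset\mathbb{K}^2\times\mathbb{K}^2\times\mathbb{K}$ is the algebraic set of $(\bar x,\bar y,w)$ with $f(y_1,y_2)=0$, $(x_1-y_1)^2+(x_2-y_2)^2=d^2$, $(y_2-b)(x_1-y_1)-(y_1-a)(x_2-y_2)=0$, $w((y_1-a)^2+(y_2-b)^2)=1$. With $\pi_1(\bar x,\bar y,w)=\bar x$, the conchoid $\mathfrak{C}(\mathcal{C},A,d)$ is the Zariski closure in $\mathbb{K}^2$ of $\pi_1(\mathfrak{B}(\mathcal{C},A,d))$. $\mathcal{C}_0=\{(p_1,p_2)\in\mathcal{C}:(p_1-a)^2+(p_2-b)^2\neq0\}$. *)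

theory Defs
  imports "HOL-Computational_Algebra.Polynomial" "HOL-Library.Extended_Nat"
begin

definition alg_closed :: "'a::field itself \<Rightarrow> bool" where
  "alg_closed _ \<longleftrightarrow> (\<forall>p::'a poly. degree p > 0 \<longrightarrow> (\<exists>x. poly p x = 0))"

text \<open>Bivariate polynomials K[y1,y2] represented as (K[y2])[y1].\<close>
definition eval2 :: "'a::comm_semiring_1 poly poly \<Rightarrow> 'a \<Rightarrow> 'a \<Rightarrow> 'a" where
  "eval2 f y1 y2 = poly (map_poly (\<lambda>c. poly c y2) f) y1"

text \<open>Polynomial functions on K^n (points of K^n are lists of length n).\<close>
inductive_set poly_fun :: "nat \<Rightarrow> ('a::comm_ring_1 list \<Rightarrow> 'a) set" for n where
  const: "(\<lambda>x. c) \<in> poly_fun n"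
| var: "i < n \<Longrightarrow> (\<lambda>x. x ! i) \<in> poly_fun n"
| add: "p \<in> poly_fun n \<Longrightarrow> q \<in> poly_fun n \<Longrightarrow> (\<lambda>x. p x + q x) \<in> poly_fun n"
| mult: "p \<in> poly_fun n \<Longrightarrow> q \<in> poly_fun n \<Longrightarrow> (\<lambda>x. p x * q x) \<in> poly_fun n"

definition affine_space :: "nat \<Rightarrow> 'a list set" where
  "affine_space n = {x. length x = n}"

definition zero_set :: "nat \<Rightarrow> ('a::comm_ring_1 list \<Rightarrow> 'a) set \<Rightarrow> 'a list set" where
  "zero_set n S = {x \<in> affine_space n. \<forall>p\<in>S. p x = 0}"

definition zclosed :: "nat \<Rightarrow> 'a::comm_ring_1 list set \<Rightarrow> bool" where
  "zclosed n X \<longleftrightarrow> (\<exists>S \<subseteq> poly_fun n. X = zero_set n S)"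

definition zclosure :: "nat \<Rightarrow> 'a::comm_ring_1 list set \<Rightarrow> 'a list set" where
  "zclosure n X = \<Inter>{Y. zclosed n Y \<and> X \<subseteq> Y}"

definition zirreducible :: "nat \<Rightarrow> 'a::comm_ring_1 list set \<Rightarrow> bool" where
  "zirreducible n X \<longleftrightarrow> zclosed n X \<and> X \<noteq> {} \<and>
     (\<forall>Y Z. zclosed n Y \<and> zclosed n Z \<and> X = Y \<union> Z \<longrightarrow> X = Y \<or> X = Z)"

definition irr_components :: "nat \<Rightarrow> 'a::comm_ring_1 list set \<Rightarrow> 'a list set set" where
  "irr_components n X = {Z. Z \<subseteq> X \<and> zirreducible n Z \<and>
     (\<forall>W. zirreducible n W \<and> Z \<subseteq> W \<and> W \<subseteq> X \<longrightarrow> W = Z)}"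

definition zdim :: "nat \<Rightarrow> 'a::comm_ring_1 list set \<Rightarrow> enat" where
  "zdim n X = Sup {enat k | k. \<exists>Z :: nat \<Rightarrow> 'a list set.
      (\<forall>i\<le>k. zirreducible n (Z i) \<and> Z i \<subseteq> X) \<and> (\<forall>i<k. Z i \<subset> Z (Suc i))}"

definition curve :: "'a::comm_ring_1 poly poly \<Rightarrow> 'a list set" where
  "curve f = {[y1, y2] | y1 y2. eval2 f y1 y2 = 0}"

definition circle :: "'a::comm_ring_1 \<Rightarrow> 'a \<Rightarrow> 'a \<Rightarrow> 'a list set" where
  "circle c1 c2 r = {[x1, x2] | x1 x2. (x1 - c1)^2 + (x2 - c2)^2 = r^2}"

definition C0 :: "'a::comm_ring_1 poly poly \<Rightarrow> 'a \<Rightarrow> 'a \<Rightarrow> 'a list set" where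
  "C0 f a b = {p \<in> curve f. (p!0 - a)^2 + (p!1 - b)^2 \<noteq> 0}"

definition Bset :: "'a::comm_ring_1 poly poly \<Rightarrow> 'a \<Rightarrow> 'a \<Rightarrow> 'a \<Rightarrow> 'a list set" where
  "Bset f a b d = {[x1, x2, y1, y2, w] | x1 x2 y1 y2 w.
      eval2 f y1 y2 = 0 \<and>
      (x1 - y1)^2 + (x2 - y2)^2 = d^2 \<and>
      (y2 - b) * (x1 - y1) - (y1 - a) * (x2 - y2) = 0 \<and>
      w * ((y1 - a)^2 + (y2 - b)^2) = 1}"

definition pi1 :: "'a list \<Rightarrow> 'a list" where
  "pi1 p = [p!0, p!1]"

definition conchoid :: "'a::comm_ring_1 poly poly \<Rightarrow> 'a \<Rightarrow> 'a \<Rightarrow> 'a \<Rightarrow> 'a list set" where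
  "conchoid f a b d = zclosure 2 (pi1 ` Bset f a b d)"

end

(* On C_0 the points of B over y are x = y + t (y - A), w = t^2/d^2 with t^2 N(y) = d^2, where
   N(y) = |y - A|^2, so B is a double cover of C_0 with covering involution t -> -t, that is
   x -> 2y - x (called flip below). Up to a power of N every function on B is P(y) + t Q(y), and
   multiplying by its conjugate gives a polynomial in y, which has finitely many zeros on the
   irreducible curve unless it vanishes there. Hence every infinite closed subset of B covers B
   together with its flip. It follows that B is the union of an irreducible curve Y and its flip,
   and that the conchoid is the union of the closures of their projections.

   The projections lie on a curve: away from A, the same formula with the roles of x and y exchanged
   recovers y from x up to the sign of a square root, and f(y) times its conjugate is a nonzero
   polynomial in x. A projection can only be a single point if that point is A and the curve is the
   circle of radius d around A. *)
theory Submission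
  imports Defs
begin

section \<open>Bivariate polynomials\<close>

text \<open>Dimension is defined by chains of irreducible closed sets, so only finiteness has to be
  controlled: an infinite irreducible set in which proper closed subsets of irreducible sets are
  finite has dimension 1. Whether B is irreducible depends on whether N is a square in the function
  field of the curve. The proof never decides this; the set Y with its flip covering B may be all of
  B. Everything rests on a weak form of Bezout's theorem: an irreducible polynomial and one that it
  does not divide have finitely many common zeros. It comes from pseudo-division in K[y2][y1], where
  the obstacle is the factors from K[y2] that pseudo-division introduces. Over an algebraically
  closed field they split into linear factors y2 - \<alpha>, which are prime and can be cancelled
  one at a time.\<close>

lemma eval2_0 [simp]: "eval2 0 y1 y2 = 0"
  by (simp add: eval2_def)

lemma eval2_pCons [simp]: "eval2 (pCons c q) y1 y2 = poly c y2 + y1 * eval2 q y1 y2"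
  by (simp add: eval2_def map_poly_pCons)

lemma eval2_1 [simp]: "eval2 1 y1 y2 = 1"
  by (simp add: one_pCons)

lemma eval2_add [simp]: "eval2 (p + q) y1 y2 = eval2 p y1 y2 + eval2 q y1 y2"
proof (induction p arbitrary: q)
  case (pCons c p)
  then show ?case by (cases q) (simp add: algebra_simps)
qed simp

lemma eval2_smult [simp]: "eval2 (smult c q) y1 y2 = poly c y2 * eval2 q y1 y2"
  by (induction q) (simp_all add: algebra_simps)

lemma eval2_mult [simp]:
  fixes p q :: "'a::comm_semiring_1 poly poly"
  shows "eval2 (p * q) y1 y2 = eval2 p y1 y2 * eval2 q y1 y2"
  by (induction p) (simp_all add: algebra_simps)

lemma eval2_minus [simp]:
  fixes p :: "'a::comm_ring_1 poly poly"
  shows "eval2 (- p) y1 y2 = - eval2 p y1 y2"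
  using eval2_smult[of "-1" p y1 y2] by simp

lemma eval2_diff [simp]:
  fixes p q :: "'a::comm_ring_1 poly poly"
  shows "eval2 (p - q) y1 y2 = eval2 p y1 y2 - eval2 q y1 y2"
  using eval2_add[of p "- q" y1 y2] by simp

lemma eval2_power [simp]:
  fixes p :: "'a::comm_semiring_1 poly poly"
  shows "eval2 (p ^ k) y1 y2 = eval2 p y1 y2 ^ k"
  by (induction k) simp_all

lemma eval2_dvd_zero:
  fixes f g :: "'a::comm_semiring_1 poly poly"
  assumes "f dvd g" "eval2 f y1 y2 = 0"
  shows "eval2 g y1 y2 = 0"
  using assms by auto

text \<open>One induction serves every class of functions used below: polynomial functions on K^n,
  polynomials in one variable, Laurent polynomials on the circle, and functions on the double
  cover.\<close>

lemma eval2_closure: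
  fixes q :: "'a::comm_ring_1 poly poly"
  assumes const: "\<And>c. (\<lambda>_. c) \<in> R"
    and add: "\<And>g h. g \<in> R \<Longrightarrow> h \<in> R \<Longrightarrow> (\<lambda>x. g x + h x) \<in> R"
    and mult: "\<And>g h. g \<in> R \<Longrightarrow> h \<in> R \<Longrightarrow> (\<lambda>x. g x * h x) \<in> R"
    and "u \<in> R" "v \<in> R"
  shows "(\<lambda>x. eval2 q (u x) (v x)) \<in> R"
proof (induction q)
  case 0
  show ?case using const by simp
next
  case (pCons c q)
  have "(\<lambda>x. poly c (v x)) \<in> R"
  proof (induction c)
    case 0
    show ?case using const by simp
  next
    case (pCons k c)
    then show ?case using add[OF const mult[OF \<open>v \<in> R\<close> pCons.IH]] by simp
  qed
  from add[OF this mult[OF \<open>u \<in> R\<close> pCons.IH]] show ?case by simp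
qed

text \<open>The same device for pulling polynomial functions back along \<open>\<phi>\<close>, whose
  domain need not consist of lists: below it also consists of pairs and of triples (y1, y2,
  t).\<close>

lemma poly_fun_closure:
  assumes "p \<in> poly_fun m"
    and const: "\<And>c. (\<lambda>_. c) \<in> R"
    and add: "\<And>g h. g \<in> R \<Longrightarrow> h \<in> R \<Longrightarrow> (\<lambda>x. g x + h x) \<in> R"
    and mult: "\<And>g h. g \<in> R \<Longrightarrow> h \<in> R \<Longrightarrow> (\<lambda>x. g x * h x) \<in> R"
    and var: "\<And>i. i < m \<Longrightarrow> (\<lambda>x. \<phi> x ! i) \<in> R"
  shows "(\<lambda>x. p (\<phi> x)) \<in> R"
  using assms(1) by induction (auto intro: const add mult var)

lemma eval2_poly_fun:
  assumes "u \<in> poly_fun n" "v \<in> poly_fun n"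
  shows "(\<lambda>x. eval2 q (u x) (v x)) \<in> poly_fun n"
  by (rule eval2_closure) (auto intro: poly_fun.intros assms)

lemma poly_fun_compose:
  assumes "p \<in> poly_fun m" "\<And>i. i < m \<Longrightarrow> (\<lambda>x. \<phi> x ! i) \<in> poly_fun n"
  shows "(\<lambda>x. p (\<phi> x)) \<in> poly_fun n"
  using assms(1) by (rule poly_fun_closure) (auto intro: poly_fun.intros assms)

lemma poly_fun_diff:
  assumes "p \<in> poly_fun n" "q \<in> poly_fun n"
  shows "(\<lambda>x. p x - q x) \<in> poly_fun n"
  using poly_fun.add[OF assms(1) poly_fun.mult[OF poly_fun.const[of "-1"] assms(2)]] by simp

lemma poly_fun_power: "p \<in> poly_fun n \<Longrightarrow> (\<lambda>x. p x ^ k) \<in> poly_fun n"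
  by (induction k) (auto intro: poly_fun.intros)

lemma poly_fun_2_eval2:
  assumes "p \<in> poly_fun 2"
  obtains q where "\<And>y1 y2. p [y1, y2] = eval2 q y1 y2"
proof -
  let ?R = "{g. \<exists>q. \<forall>y1 y2. g (y1, y2) = eval2 q y1 y2}"
  have "(\<lambda>y. p [fst y, snd y]) \<in> ?R"
  proof (rule poly_fun_closure[OF assms])
    show "(\<lambda>_. c) \<in> ?R" for c
      by (auto intro!: exI[of _ "[:[:c:]:]"])
    show "(\<lambda>x. g x + h x) \<in> ?R" if "g \<in> ?R" "h \<in> ?R" for g h
      using that by clarsimp (metis eval2_add)
    show "(\<lambda>x. g x * h x) \<in> ?R" if "g \<in> ?R" "h \<in> ?R" for g h
      using that by clarsimp (metis eval2_mult)
    show "(\<lambda>y. [fst y, snd y] ! i) \<in> ?R" if "i < 2" for i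
    proof (cases "i = 0")
      case True
      then show ?thesis by (auto intro!: exI[of _ "[:0, 1:]"])
    next
      case False
      then have "i = 1" using that by simp
      then show ?thesis by (auto intro!: exI[of _ "[:[:0, 1:]:]"])
    qed
  qed
  then show thesis using that by auto
qed

section \<open>Specialization of y2 and cancellation of factors from K[y2]\<close>

lemma map_poly_eq_0_iff_eval2:
  fixes p :: "'a::field_char_0 poly poly"
  shows "map_poly (\<lambda>c. poly c \<alpha>) p = 0 \<longleftrightarrow> (\<forall>y. eval2 p y \<alpha> = 0)"
  unfolding eval2_def by (metis poly_all_0_iff_0)

text \<open>Both sides say that every coefficient of \<open>p\<close>, a polynomial in y2, vanishes
  at \<alpha>; on the left because a polynomial that vanishes everywhere on an infinite field is
  zero.\<close>

lemma eval2_eq_0_iff_linear_dvd: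
  fixes p :: "'a::field_char_0 poly poly"
  shows "(\<forall>y. eval2 p y \<alpha> = 0) \<longleftrightarrow> [:[:-\<alpha>, 1:]:] dvd p"
proof -
  have "map_poly (\<lambda>c. poly c \<alpha>) p = 0 \<longleftrightarrow> (\<forall>n. poly (coeff p n) \<alpha> = 0)"
    by (simp add: poly_eq_iff coeff_map_poly)
  also have "\<dots> \<longleftrightarrow> [:[:-\<alpha>, 1:]:] dvd p"
    by (simp add: const_poly_dvd_iff poly_eq_0_iff_dvd)
  finally show ?thesis by (simp add: map_poly_eq_0_iff_eval2)
qed

text \<open>y2 - \<alpha> is prime because substituting \<alpha> for y2 is a ring homomorphism to
  K[y1], which has no zero divisors.\<close>

lemma linear_dvd_mult:
  fixes p q :: "'a::field_char_0 poly poly"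
  assumes "[:[:-\<alpha>, 1:]:] dvd p * q"
  shows "[:[:-\<alpha>, 1:]:] dvd p \<or> [:[:-\<alpha>, 1:]:] dvd q"
proof -
  have "\<forall>y. eval2 p y \<alpha> * eval2 q y \<alpha> = 0"
    using assms by (subst (asm) eval2_eq_0_iff_linear_dvd[symmetric]) simp
  then have "map_poly (\<lambda>c. poly c \<alpha>) p * map_poly (\<lambda>c. poly c \<alpha>) q = 0"
    unfolding eval2_def by (subst poly_all_0_iff_0[symmetric]) (simp add: poly_mult)
  then show ?thesis
    by (simp add: map_poly_eq_0_iff_eval2 eval2_eq_0_iff_linear_dvd)
qed

lemma eval2_nonzero_point:
  fixes g :: "'a::field_char_0 poly poly"
  assumes "g \<noteq> 0"
  obtains y1 y2 where "eval2 g y1 y2 \<noteq> 0"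
proof -
  have "lead_coeff g \<noteq> 0" using assms by simp
  then obtain y2 where "poly (lead_coeff g) y2 \<noteq> 0"
    using poly_all_0_iff_0 by blast
  then have "coeff (map_poly (\<lambda>c. poly c y2) g) (degree g) \<noteq> 0"
    by (simp add: coeff_map_poly)
  then have "map_poly (\<lambda>c. poly c y2) g \<noteq> 0" by force
  then show thesis using that by (auto simp: map_poly_eq_0_iff_eval2)
qed

text \<open>This takes the place of Gauss's lemma. Up to a scalar, \<open>c\<close> is a product of
  linear factors y2 - \<alpha>; each is prime, so it can be cancelled from \<open>q\<close> or from
  \<open>m\<close>, and the degree of \<open>m\<close> in y1 does not change.\<close>

lemma cancel_constant_factor:
  fixes f q m :: "'a::field_char_0 poly poly"
  assumes "alg_closed TYPE('a)" "c \<noteq> 0" "smult c f = q * m"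
  obtains q0 m0 where "f = q0 * m0" "degree m0 = degree m" "m0 dvd m"
  using assms(2,3)
proof (induction "degree c" arbitrary: c q m thesis)
  case 0
  then obtain k where k: "c = [:k:]" "k \<noteq> 0"
    by (metis degree_eq_zeroE pCons_eq_0_iff)
  have "f = smult [:1 / k:] (smult c f)" using k by (simp add: one_pCons[symmetric])
  also have "\<dots> = smult [:1 / k:] q * m" using 0 by simp
  finally show ?case using 0(2)[of "smult [:1/k:] q" m] by simp
next
  case (Suc n)
  obtain \<alpha> where "poly c \<alpha> = 0"
    using assms(1) Suc(2) unfolding alg_closed_def by (metis zero_less_Suc)
  then obtain c' where c': "c = [:-\<alpha>, 1:] * c'"
    by (meson dvdE poly_eq_0_iff_dvd)
  let ?l = "[:[:-\<alpha>, 1:]:]"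
  have nz: "c' \<noteq> 0" "?l \<noteq> 0" using c' Suc.prems(2) by auto
  have "degree c = Suc (degree c')"
    unfolding c' using nz by (subst degree_mult_eq) auto
  with Suc(2) have deg: "n = degree c'" by simp
  have eq: "?l * smult c' f = q * m"
    using Suc.prems(3) c' by simp
  then have "?l dvd q * m" by (metis dvd_triv_left)
  then consider q' where "q = ?l * q'" | m' where "m = ?l * m'"
    using linear_dvd_mult by (metis dvdE)
  then show ?case
  proof cases
    case 1
    then have "?l * smult c' f = ?l * (q' * m)" using eq by (simp add: mult.assoc)
    then have "smult c' f = q' * m" using nz by (metis mult_left_cancel)
    from Suc.hyps(1)[OF deg _ nz(1) this] Suc.prems(1) show ?thesis by blast
  next
    case 2
    then have "?l * smult c' f = ?l * (q * m')" using eq by (simp add: ac_simps)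
    then have e: "smult c' f = q * m'" using nz by (metis mult_left_cancel)
    have d: "degree m = degree m'"
      using 2 nz by (cases "m' = 0") (simp_all add: degree_mult_eq)
    show ?thesis
      using Suc.hyps(1)[OF deg _ nz(1) e] Suc.prems(1) d 2 by (metis dvd_mult)
  qed
qed

text \<open>Units have degree 0 in y1, so \<open>m0\<close>, of the same degree as \<open>m\<close>,
  is not a unit; hence \<open>q0\<close> is, and \<open>m0\<close> is an associate of
  \<open>f\<close>.\<close>

lemma irreducible_dvd_of_smult_eq:
  fixes f g m :: "'a::field_char_0 poly poly"
  assumes "alg_closed TYPE('a)" "irreducible f" "c \<noteq> 0" "smult c f = q * m" "degree m > 0"
  shows "f dvd m"
proof -
  obtain q0 m0 where m0: "f = q0 * m0" "degree m0 = degree m" "m0 dvd m"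
    using cancel_constant_factor[OF assms(1,3,4)] by blast
  have "\<not> m0 dvd 1" using m0(2) assms(5) by (auto simp: is_unit_poly_iff)
  then have "q0 dvd 1" using irreducibleD[OF assms(2) m0(1)] by blast
  then have "f dvd m0" using m0(1) by simp
  then show ?thesis using m0(3) dvd_trans by blast
qed

text \<open>Positive degree in y1 keeps \<open>f\<close> from being absorbed by \<open>c\<close>:
  with \<open>f\<close> and \<open>c\<close> both equal to y2 the conclusion fails already for
  \<open>g\<close> = 1.\<close>

lemma irreducible_dvd_smult_cancel:
  fixes f g :: "'a::field_char_0 poly poly"
  assumes "alg_closed TYPE('a)" "irreducible f" "c \<noteq> 0" "f dvd smult c g" "degree f > 0"
  shows "f dvd g"
proof -
  obtain q where "smult c g = q * f" using assms(4) by (metis dvdE mult.commute)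
  then obtain q0 m0 where m0: "g = q0 * m0" "degree m0 = degree f" "m0 dvd f"
    using cancel_constant_factor[OF assms(1,3)] by blast
  obtain e where e: "f = m0 * e" using m0(3) by (elim dvdE)
  have "\<not> m0 dvd 1" using m0(2) assms(5) by (auto simp: is_unit_poly_iff)
  then have "e dvd 1" using irreducibleD[OF assms(2) e] by blast
  then have "f dvd m0" using e by simp
  then show ?thesis using m0(1) by simp
qed

text \<open>A nonzero element of least degree in the ideal generated by f and g divides both of them up
  to factors from K[y2]; if its degree were positive, f would divide it and hence g.\<close>
lemma eliminate_first_variable:
  fixes f g :: "'a::field_char_0 poly poly"
  assumes ac: "alg_closed TYPE('a)" and f: "irreducible f" and g: "\<not> f dvd g"
  obtains u v h where "h \<noteq> 0" "u * f + v * g = [:h:]"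
proof -
  let ?I = "\<lambda>m. m \<noteq> 0 \<and> (\<exists>u v. m = u * f + v * g)"
  have f0: "f \<noteq> 0" using f by auto
  then have "?I f" by (metis add_0_right mult_1 mult_zero_left)
  then obtain m where m: "?I m" and least: "\<And>m'. ?I m' \<Longrightarrow> degree m \<le> degree m'"
    using ex_has_least_nat[of ?I f degree] by auto
  obtain u v where uv: "m = u * f + v * g" using m by blast
  have division: "\<exists>c q. c \<noteq> 0 \<and> smult c p = q * m" if p: "p = u' * f + v' * g" for p u' v'
  proof -
    obtain q r where qr: "pseudo_divmod p m = (q, r)" by force
    define c where "c = lead_coeff m ^ (Suc (degree p) - degree m)"
    have *: "smult c p = m * q + r" "r = 0 \<or> degree r < degree m"
      using pseudo_divmod[OF _ qr] m by (auto simp: c_def)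
    have "r = smult c p - m * q" using * by simp
    also have "\<dots> = (smult c u' - q * u) * f + (smult c v' - q * v) * g"
      unfolding p uv by (simp add: algebra_simps smult_add_right)
    finally have "r \<noteq> 0 \<Longrightarrow> degree m \<le> degree r" by (intro least) blast
    then have "r = 0" using *(2) by linarith
    then show ?thesis using * m by (intro exI[of _ c] exI[of _ q]) (simp add: c_def mult.commute)
  qed
  show thesis
  proof (cases "degree m = 0")
    case True
    then obtain h where "m = [:h:]" by (metis degree_eq_zeroE)
    then show thesis using that[of h u v] m uv by auto
  next
    case False
    obtain c q where "c \<noteq> 0" "smult c f = q * m"
      using division[of f 1 0] by auto
    then have fm: "f dvd m"
      using irreducible_dvd_of_smult_eq[OF ac f] False by blast
    show thesis
    \<comment> \<open>\<open>irreducible_dvd_smult_cancel\<close> needs positive degree in y1; an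
      \<open>f\<close> of degree 0 is itself a combination of \<open>f\<close> and \<open>g\<close>
      that is free of y1.\<close>
    proof (cases "degree f = 0")
      case True
      then obtain h where "f = [:h:]" by (metis degree_eq_zeroE)
      then show thesis using that[of h 1 0] f0 by auto
    next
      case False
      obtain c' q' where c': "c' \<noteq> 0" "smult c' g = q' * m"
        using division[of g 0 1] by auto
      then have "f dvd smult c' g" using fm by simp
      then have "f dvd g"
        using irreducible_dvd_smult_cancel[OF ac f c'(1)] False by blast
      then show thesis using g by blast
    qed
  qed
qed

section \<open>Zeros of an irreducible polynomial\<close>

lemma finite_common_zeros:
  fixes f g :: "'a::field_char_0 poly poly"
  assumes ac: "alg_closed TYPE('a)" and f: "irreducible f" and g: "\<not> f dvd g"
  shows "finite {(y1, y2). eval2 f y1 y2 = 0 \<and> eval2 g y1 y2 = 0}"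
proof -
  obtain u v h where h: "h \<noteq> 0" "u * f + v * g = [:h:]"
    using eliminate_first_variable[OF assms] .
  let ?F = "\<lambda>y2. {y1. eval2 f y1 y2 = 0 \<and> eval2 g y1 y2 = 0}"
  have root: "poly h y2 = 0" if "eval2 f y1 y2 = 0" "eval2 g y1 y2 = 0" for y1 y2
    using arg_cong[OF h(2), of "\<lambda>p. eval2 p y1 y2"] that by simp
  \<comment> \<open>\<open>h\<close> restricts only y2. A single line y2 = const carries finitely
    many common zeros unless both polynomials vanish on all of it.\<close>
  have fin: "finite (?F y2)" for y2
  proof (cases "\<forall>y. eval2 f y y2 = 0")
    case False
    then have "map_poly (\<lambda>c. poly c y2) f \<noteq> 0" by (simp add: map_poly_eq_0_iff_eval2)
    then have "finite {y. eval2 f y y2 = 0}" unfolding eval2_def by (rule poly_roots_finite)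
    then show ?thesis by (rule rev_finite_subset) auto
  next
    case True
    then have l: "[:[:-y2, 1:]:] dvd f" by (simp add: eval2_eq_0_iff_linear_dvd)
    then obtain e where e: "f = [:[:-y2, 1:]:] * e" by (elim dvdE)
    have "\<not> [:[:-y2, 1:]:] dvd 1" by (simp add: is_unit_const_poly_iff is_unit_pCons_iff)
    then have "e dvd 1" using irreducibleD[OF f e] by blast
    \<comment> \<open>An irreducible \<open>f\<close> that vanishes on the line is an associate of
      its equation; if \<open>g\<close> vanished there too, \<open>f\<close> would divide
      \<open>g\<close>.\<close>
    then have "f dvd [:[:-y2, 1:]:]" by (subst e) (simp only: mult_unit_dvd_iff dvd_refl)
    then have "\<not> [:[:-y2, 1:]:] dvd g" using g dvd_trans by blast
    then have "map_poly (\<lambda>c. poly c y2) g \<noteq> 0"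
      by (simp add: map_poly_eq_0_iff_eval2 eval2_eq_0_iff_linear_dvd)
    then have "finite {y. eval2 g y y2 = 0}" unfolding eval2_def by (rule poly_roots_finite)
    then show ?thesis by (rule rev_finite_subset) auto
  qed
  have "finite (\<Union>y2\<in>{y2. poly h y2 = 0}. (\<lambda>y1. (y1, y2)) ` ?F y2)"
    using poly_roots_finite[OF h(1)] fin by blast
  then show ?thesis by (rule rev_finite_subset) (use root in auto)
qed

text \<open>Either \<open>f\<close> depends on y2 alone and its zeros contain a line, or over every
  y2 outside the finitely many roots of the leading coefficient the polynomial in y1 keeps its
  positive degree and has a root.\<close>

lemma infinite_zeros:
  fixes f :: "'a::field_char_0 poly poly"
  assumes ac: "alg_closed TYPE('a)" and f: "irreducible f"
  shows "infinite {(y1, y2). eval2 f y1 y2 = 0}" (is "infinite ?V")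
proof (cases "degree f = 0")
  case True
  then obtain c where c: "f = [:c:]" by (metis degree_eq_zeroE)
  have "c \<noteq> 0" using f c by auto
  have "degree c > 0"
  proof (rule ccontr)
    assume "\<not> degree c > 0"
    then obtain k where "c = [:k:]" by (metis degree_eq_zeroE not_gr_zero)
    then have "f dvd 1" using c \<open>c \<noteq> 0\<close> by (simp add: is_unit_const_poly_iff dvd_field_iff)
    then show False using f by (simp add: irreducible_def)
  qed
  then obtain y2 where "poly c y2 = 0" using ac unfolding alg_closed_def by blast
  then have "range (\<lambda>y1. (y1, y2)) \<subseteq> ?V" using c by auto
  moreover have "infinite (range (\<lambda>y1 :: 'a. (y1, y2)))"
    by (subst finite_image_iff) (simp_all add: inj_on_def infinite_UNIV_char_0)
  ultimately show ?thesis using finite_subset by blast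
next
  case False
  have f0: "f \<noteq> 0" using f by auto
  have "\<exists>y1. (y1, y2) \<in> ?V" if "poly (lead_coeff f) y2 \<noteq> 0" for y2
  proof -
    have "degree f \<le> degree (map_poly (\<lambda>c. poly c y2) f)"
      using that by (intro le_degree) (simp add: coeff_map_poly)
    then have "degree (map_poly (\<lambda>c. poly c y2) f) > 0" using False by linarith
    then obtain y1 where "poly (map_poly (\<lambda>c. poly c y2) f) y1 = 0"
      using ac unfolding alg_closed_def by blast
    then show ?thesis by (auto simp: eval2_def)
  qed
  then have "UNIV - {y2. poly (lead_coeff f) y2 = 0} \<subseteq> snd ` ?V" by force
  moreover have "infinite (UNIV - {y2. poly (lead_coeff f) y2 = 0})"
    using poly_roots_finite[of "lead_coeff f"] f0 by (intro Diff_infinite_finite) (auto simp: infinite_UNIV_char_0)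
  ultimately show ?thesis using finite_subset finite_imageI by blast
qed

section \<open>The Zariski topology\<close>

lemma in_zero_set: "x \<in> zero_set n S \<longleftrightarrow> length x = n \<and> (\<forall>p\<in>S. p x = 0)"
  by (simp add: zero_set_def affine_space_def)

lemma zclosed_length: "zclosed n X \<Longrightarrow> x \<in> X \<Longrightarrow> length x = n"
  by (auto simp: zclosed_def in_zero_set)

lemma zclosed_separate:
  assumes "zclosed n X" "x \<notin> X" "length x = n"
  obtains p where "p \<in> poly_fun n" "\<And>y. y \<in> X \<Longrightarrow> p y = 0" "p x \<noteq> 0"
proof -
  obtain S where S: "S \<subseteq> poly_fun n" "X = zero_set n S" using assms(1) by (auto simp: zclosed_def)
  then obtain p where "p \<in> S" "p x \<noteq> 0" using assms(2,3) by (auto simp: in_zero_set)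
  then show thesis using that[of p] S by (auto simp: in_zero_set)
qed

lemma zclosedI: "S \<subseteq> poly_fun n \<Longrightarrow> X = zero_set n S \<Longrightarrow> zclosed n X"
  by (auto simp: zclosed_def)

text \<open>The family must be nonempty because the empty intersection consists of lists of every
  length and is not a closed subset of K^n.\<close>

lemma zclosed_Inter:
  assumes "\<And>X. X \<in> A \<Longrightarrow> zclosed n X" "A \<noteq> {}"
  shows "zclosed n (\<Inter>A)"
proof -
  have "\<Inter>A = zero_set n {p \<in> poly_fun n. \<exists>X\<in>A. \<forall>x\<in>X. p x = 0}" (is "_ = ?Z")
  proof
    show "\<Inter>A \<subseteq> ?Z" 
    proof
      fix x assume x: "x \<in> \<Inter>A"
      obtain X where "X \<in> A" using assms(2) by blast
      then have "length x = n" using x zclosed_length[OF assms(1)] by blast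
      then show "x \<in> ?Z" using x by (auto simp: in_zero_set)
    qed
    show "?Z \<subseteq> \<Inter>A"
    proof (intro subsetI InterI)
      fix x X assume x: "x \<in> ?Z" and X: "X \<in> A"
      then have len: "length x = n" by (simp add: in_zero_set)
      show "x \<in> X"
      proof (rule ccontr)
        assume "x \<notin> X"
        then obtain p where "p \<in> poly_fun n" "\<And>y. y \<in> X \<Longrightarrow> p y = 0" "p x \<noteq> 0"
          by (rule zclosed_separate[OF assms(1)[OF X] _ len]) (rule that)
        then show False using x X by (auto simp: in_zero_set)
      qed
    qed
  qed
  then show ?thesis by (rule zclosedI[rotated]) auto
qed

lemma zclosed_Int: "zclosed n X \<Longrightarrow> zclosed n Y \<Longrightarrow> zclosed n (X \<inter> Y)"
  using zclosed_Inter[of "{X, Y}" n] by auto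

lemma zclosed_Un:
  fixes X Y :: "'a::idom list set"
  assumes "zclosed n X" "zclosed n Y"
  shows "zclosed n (X \<union> Y)"
proof -
  let ?S = "{p \<in> poly_fun n. \<forall>x\<in>X \<union> Y. p x = 0}"
  have "X \<union> Y = zero_set n ?S"
  proof
    show "X \<union> Y \<subseteq> zero_set n ?S" using assms zclosed_length by (auto simp: in_zero_set)
    show "zero_set n ?S \<subseteq> X \<union> Y"
    proof (rule subsetI, rule ccontr)
      fix x assume x: "x \<in> zero_set n ?S" "x \<notin> X \<union> Y"
      then have len: "length x = n" and notin: "x \<notin> X" "x \<notin> Y" by (simp_all add: in_zero_set)
      obtain p where p: "p \<in> poly_fun n" "\<And>y. y \<in> X \<Longrightarrow> p y = 0" "p x \<noteq> 0"
        by (rule zclosed_separate[OF assms(1) notin(1) len]) (rule that)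
      obtain q where q: "q \<in> poly_fun n" "\<And>y. y \<in> Y \<Longrightarrow> q y = 0" "q x \<noteq> 0"
        by (rule zclosed_separate[OF assms(2) notin(2) len]) (rule that)
      have "(\<lambda>x. p x * q x) \<in> ?S" using p q by (auto intro: poly_fun.mult)
      then have "p x * q x = 0" using x(1) unfolding in_zero_set by fast
      then show False using p q by simp
    qed
  qed
  then show ?thesis by (rule zclosedI[rotated]) auto
qed

lemma zclosed_affine_space: "zclosed n (affine_space n)"
  by (rule zclosedI[of "{}"]) (simp_all add: zero_set_def)

lemma zclosed_vanishing: "p \<in> poly_fun n \<Longrightarrow> zclosed n {x \<in> affine_space n. p x = 0}"
  by (rule zclosedI[of "{p}"]) (simp_all add: zero_set_def)

lemma zclosed_singleton:
  assumes "length x = n"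
  shows "zclosed n {x :: 'a::comm_ring_1 list}"
proof -
  have "{x} = zero_set n ((\<lambda>i y. y ! i - x ! i) ` {..<n})"
    using assms by (auto simp: in_zero_set list_eq_iff_nth_eq)
  moreover have "(\<lambda>i y. y ! i - x ! i) ` {..<n} \<subseteq> poly_fun n"
    by (intro image_subsetI poly_fun_diff poly_fun.var poly_fun.const) simp
  ultimately show ?thesis by (rule zclosedI[rotated])
qed

lemma zclosed_vimage:
  assumes "zclosed m X"
    and "\<And>x. length x = n \<Longrightarrow> length (\<phi> x) = m"
    and "\<And>i. i < m \<Longrightarrow> (\<lambda>x. \<phi> x ! i) \<in> poly_fun n"
  shows "zclosed n {x \<in> affine_space n. \<phi> x \<in> X}"
proof -
  obtain S where S: "S \<subseteq> poly_fun m" "X = zero_set m S" using assms(1) unfolding zclosed_def by blast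
  have "{x \<in> affine_space n. \<phi> x \<in> X} = zero_set n ((\<lambda>p x. p (\<phi> x)) ` S)"
    by (rule set_eqI) (simp add: S(2) in_zero_set affine_space_def assms(2) cong: conj_cong)
  moreover have "(\<lambda>p x. p (\<phi> x)) ` S \<subseteq> poly_fun n"
  proof (rule image_subsetI)
    fix p assume "p \<in> S"
    then have "p \<in> poly_fun m" using S(1) by blast
    then show "(\<lambda>x. p (\<phi> x)) \<in> poly_fun n" using assms(3) by (rule poly_fun_compose)
  qed
  ultimately show ?thesis by (rule zclosedI[rotated])
qed

lemma zclosure_subset: "X \<subseteq> zclosure n X"
  by (auto simp: zclosure_def)

lemma zclosure_least: "zclosed n Y \<Longrightarrow> X \<subseteq> Y \<Longrightarrow> zclosure n X \<subseteq> Y"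
  by (auto simp: zclosure_def)

lemma zclosed_zclosure: "X \<subseteq> affine_space n \<Longrightarrow> zclosed n (zclosure n X)"
  unfolding zclosure_def using zclosed_affine_space[of n] by (intro zclosed_Inter) auto

lemma zclosure_eq: "zclosed n X \<Longrightarrow> zclosure n X = X"
  by (simp add: subset_antisym zclosure_least zclosure_subset)

lemma zclosure_Un:
  fixes X Y :: "'a::idom list set"
  assumes "X \<subseteq> affine_space n" "Y \<subseteq> affine_space n"
  shows "zclosure n (X \<union> Y) = zclosure n X \<union> zclosure n Y"
proof
  show "zclosure n (X \<union> Y) \<subseteq> zclosure n X \<union> zclosure n Y"
    using zclosure_subset[of X n] zclosure_subset[of Y n]
    by (intro zclosure_least zclosed_Un zclosed_zclosure assms) blast
  show "zclosure n X \<union> zclosure n Y \<subseteq> zclosure n (X \<union> Y)"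
    using zclosure_subset[of "X \<union> Y" n] assms
    by (intro Un_least zclosure_least zclosed_zclosure) auto
qed

section \<open>Irreducible sets, components and dimension\<close>

lemma zirreducible_closed: "zirreducible n X \<Longrightarrow> zclosed n X"
  by (simp add: zirreducible_def)

lemma zirreducible_subset_Un:
  assumes "zirreducible n X" "zclosed n Y" "zclosed n Z" "X \<subseteq> Y \<union> Z"
  shows "X \<subseteq> Y \<or> X \<subseteq> Z"
proof -
  have "zclosed n (X \<inter> Y)" "zclosed n (X \<inter> Z)" "X = (X \<inter> Y) \<union> (X \<inter> Z)"
    using assms zclosed_Int[of n X] zirreducible_closed[OF assms(1)] by blast+
  then have "X = X \<inter> Y \<or> X = X \<inter> Z" using assms(1) unfolding zirreducible_def by blast
  then show ?thesis by blast
qed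

lemma zirreducible_singleton: "length x = n \<Longrightarrow> zirreducible n {x :: 'a::comm_ring_1 list}"
proof -
  have "{x} = Y \<or> {x} = Z" if "{x} = Y \<union> Z" for Y Z using that by (metis singleton_Un_iff)
  then show "length x = n \<Longrightarrow> zirreducible n {x}"
    unfolding zirreducible_def using zclosed_singleton[of x n] by simp
qed

text \<open>Nonempty subsets of \<open>X\<close> are finite unions of points, hence closed, so a
  second point would split \<open>X\<close>.\<close>

lemma zirreducible_finite:
  fixes X :: "'a::idom list set"
  assumes "finite X" "zirreducible n X"
  obtains x where "X = {x}"
proof -
  have closed: "finite Y \<Longrightarrow> Y \<noteq> {} \<Longrightarrow> Y \<subseteq> X \<Longrightarrow> zclosed n Y" for Y
  proof (induction Y rule: finite_ne_induct)
    case (insert x F)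
    have "length x = n" using insert.prems zclosed_length[OF zirreducible_closed[OF assms(2)]] by blast
    then show ?case
      using zclosed_Un[OF zclosed_singleton[of x n] insert.IH] insert.prems by simp
  next
    case (singleton x)
    then show ?case
      using zclosed_length[OF zirreducible_closed[OF assms(2)]] by (intro zclosed_singleton) blast
  qed
  obtain x where x: "x \<in> X" using assms(2) by (auto simp: zirreducible_def)
  show thesis
  proof (cases "X - {x} = {}")
    case True
    then show thesis using that[of x] x by blast
  next
    case False
    have "X \<subseteq> {x} \<or> X \<subseteq> X - {x}"
      using assms x False by (intro zirreducible_subset_Un[OF assms(2)] closed) auto
    then show thesis using that[of x] x by blast
  qed
qed

text \<open>A decomposition of the closure pulls back to two closed sets covering \<open>X\<close>;
  one of them contains \<open>X\<close>, and the corresponding piece then contains the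
  closure.\<close>

lemma zirreducible_zclosure_image:
  assumes X: "zirreducible n X"
    and \<phi>: "\<And>x. length x = n \<Longrightarrow> length (\<phi> x) = m"
      "\<And>i. i < m \<Longrightarrow> (\<lambda>x. \<phi> x ! i) \<in> poly_fun n"
  shows "zirreducible m (zclosure m (\<phi> ` X))"
proof -
  have len: "x \<in> X \<Longrightarrow> length x = n" for x
    using X zclosed_length by (auto simp: zirreducible_def)
  then have closed: "zclosed m (zclosure m (\<phi> ` X))"
    using \<phi>(1) by (intro zclosed_zclosure) (auto simp: affine_space_def)
  moreover have "zclosure m (\<phi> ` X) \<noteq> {}"
    using X zclosure_subset[of "\<phi> ` X" m] by (auto simp: zirreducible_def)
  moreover have "zclosure m (\<phi> ` X) = Y \<or> zclosure m (\<phi> ` X) = Z"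
    if "zclosed m Y" "zclosed m Z" "zclosure m (\<phi> ` X) = Y \<union> Z" for Y Z
  proof -
    let ?pre = "\<lambda>Y. {x \<in> affine_space n. \<phi> x \<in> Y}"
    have "X \<subseteq> ?pre Y \<union> ?pre Z"
      using that(3) zclosure_subset[of "\<phi> ` X" m] len by (auto simp: affine_space_def)
    then have "X \<subseteq> ?pre Y \<or> X \<subseteq> ?pre Z"
      using that by (intro zirreducible_subset_Un[OF X] zclosed_vimage[OF _ \<phi>])
    then have "zclosure m (\<phi> ` X) \<subseteq> Y \<or> zclosure m (\<phi> ` X) \<subseteq> Z"
      using zclosure_least[of m Y "\<phi> ` X"] zclosure_least[of m Z "\<phi> ` X"] that(1,2) by auto
    then show ?thesis using that(3) by blast
  qed
  ultimately show ?thesis unfolding zirreducible_def by blast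
qed

text \<open>Only an inclusion holds, since one of the two sets may contain the other.\<close>

lemma irr_components_Un:
  assumes "zirreducible n U" "zirreducible n V"
  shows "irr_components n (U \<union> V) \<subseteq> {U, V}"
proof
  fix Z assume "Z \<in> irr_components n (U \<union> V)"
  then have Z: "zirreducible n Z" "Z \<subseteq> U \<union> V"
    and max: "\<And>W. zirreducible n W \<Longrightarrow> Z \<subseteq> W \<Longrightarrow> W \<subseteq> U \<union> V \<Longrightarrow> W = Z"
    unfolding irr_components_def mem_Collect_eq by metis+
  have "Z \<subseteq> U \<or> Z \<subseteq> V"
    using zirreducible_subset_Un[OF Z(1) _ _ Z(2)] assms[THEN zirreducible_closed] by blast
  then show "Z \<in> {U, V}" using max[OF assms(1)] max[OF assms(2)] by blast
qed

text \<open>In a strict chain of three sets the middle one would be finite, hence a single point by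
  irreducibility, and would leave no room for a nonempty set below it. The chain from a point of
  \<open>X\<close> to \<open>X\<close> gives the lower bound.\<close>

lemma zdim_eq_1I:
  fixes X :: "'a::idom list set"
  assumes X: "zirreducible n X" "infinite X"
    and proper: "\<And>W Y. zirreducible n W \<Longrightarrow> W \<subseteq> X \<Longrightarrow> zclosed n Y \<Longrightarrow> Y \<subset> W \<Longrightarrow> finite Y"
  shows "zdim n X = 1"
  unfolding zdim_def
proof (rule antisym)
  show "Sup {enat k |k. \<exists>Z. (\<forall>i\<le>k. zirreducible n (Z i) \<and> Z i \<subseteq> X) \<and> (\<forall>i<k. Z i \<subset> Z (Suc i))} \<le> 1"
  proof (rule Sup_least, clarify)
    fix k :: nat and Z
    assume irr: "\<forall>i\<le>k. zirreducible n (Z i) \<and> Z i \<subseteq> X" and chain: "\<forall>i<k. Z i \<subset> Z (Suc i)"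
    have "k \<le> 1"
    proof (rule ccontr)
      assume "\<not> k \<le> 1"
      then have "Z 0 \<subset> Z 1" "Z 1 \<subset> Z 2" and irr: "zirreducible n (Z 0)" "zirreducible n (Z 1)"
        "zirreducible n (Z 2)" "Z 2 \<subseteq> X"
        using irr chain by (auto simp: numeral_2_eq_2 dest!: spec[of _ 0] spec[of _ 1])
      then have "finite (Z 1)"
        using proper[of "Z 2" "Z 1"] by (auto simp: zirreducible_closed)
      then obtain x where "Z 1 = {x}" using zirreducible_finite irr(2) by blast
      then show False using \<open>Z 0 \<subset> Z 1\<close> irr(1) by (auto simp: zirreducible_def)
    qed
    then show "enat k \<le> 1" by (simp add: one_enat_def)
  qed
  obtain x where x: "x \<in> X" using X(2) by fastforce
  define Z where "Z = (\<lambda>i::nat. if i = 0 then {x} else X)"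
  have "length x = n" using x X(1) zclosed_length zirreducible_closed by blast
  then have "(\<forall>i\<le>1. zirreducible n (Z i) \<and> Z i \<subseteq> X) \<and> (\<forall>i<1. Z i \<subset> Z (Suc i))"
    using x X zirreducible_singleton by (auto simp: Z_def)
  then show "1 \<le> Sup {enat k |k. \<exists>Z. (\<forall>i\<le>k. zirreducible n (Z i) \<and> Z i \<subseteq> X) \<and> (\<forall>i<k. Z i \<subset> Z (Suc i))}"
    by (intro Sup_upper) (auto simp: one_enat_def intro!: exI[of _ "1::nat"] exI[of _ Z])
qed

text \<open>The size, additive on products, measures how far a bivariate polynomial is from a unit; a
  polynomial of least size vanishing on an irreducible set is therefore irreducible.\<close>
lemma finite_proper_closed_subset_plane:
  fixes W Y :: "'a::field_char_0 list set"
  assumes ac: "alg_closed TYPE('a)"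
    and h: "h \<noteq> 0" "\<And>y1 y2. [y1, y2] \<in> W \<Longrightarrow> eval2 h y1 y2 = 0"
    and W: "zirreducible 2 W" and Y: "zclosed 2 Y" "Y \<subset> W"
  shows "finite Y"
proof -
  have list2: "\<exists>y1 y2. x = [y1, y2]" if "x \<in> W" for x
    using zclosed_length[OF zirreducible_closed[OF W] that]
    by (auto simp: length_Suc_conv numeral_2_eq_2)
  define size where "size = (\<lambda>p :: 'a poly poly. degree p + degree (lead_coeff p))"
  have size_mult: "size (p * q) = size p + size q" if "p \<noteq> 0" "q \<noteq> 0" for p q
    using that unfolding size_def lead_coeff_mult by (simp add: degree_mult_eq)
  have unit: "p dvd 1" if "p \<noteq> 0" "size p = 0" for p
  proof -
    have "degree p = 0" using that by (simp add: size_def)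
    then obtain c where c: "p = [:c:]" by (metis degree_eq_zeroE)
    moreover have "degree c = 0" using that c by (simp add: size_def)
    then obtain k where "c = [:k:]" by (metis degree_eq_zeroE)
    ultimately show ?thesis using that by (simp add: is_unit_const_poly_iff dvd_field_iff)
  qed
  let ?P = "\<lambda>p. p \<noteq> 0 \<and> (\<forall>y1 y2. [y1, y2] \<in> W \<longrightarrow> eval2 p y1 y2 = 0)"
  have "?P h" using h by blast
  then obtain p where p: "?P p" and least: "\<And>q. ?P q \<Longrightarrow> size p \<le> size q"
    using ex_has_least_nat[of ?P h size] by blast
  have "irreducible p"
  proof (rule irreducibleI)
    show "p \<noteq> 0" using p by blast
    show "\<not> p dvd 1"
    proof
      assume "p dvd 1"
      obtain x where "x \<in> W" using W by (auto simp: zirreducible_def)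
      then obtain y1 y2 where "[y1, y2] \<in> W" using list2 by blast
      then have "eval2 p y1 y2 = 0" using p by blast
      from eval2_dvd_zero[OF \<open>p dvd 1\<close> this] show False by simp
    qed
    fix u v assume uv: "p = u * v"
    then have nz: "u \<noteq> 0" "v \<noteq> 0" using p by auto
    let ?V = "\<lambda>u. {x \<in> affine_space 2. eval2 u (x ! 0) (x ! 1) = 0}"
    have closed: "zclosed 2 (?V u)" for u :: "'a poly poly"
      by (intro zclosed_vanishing eval2_poly_fun poly_fun.var) auto
    have "W \<subseteq> ?V u \<union> ?V v" using p list2 by (force simp: uv affine_space_def)
    then have "W \<subseteq> ?V u \<or> W \<subseteq> ?V v"
      using zirreducible_subset_Un[OF W closed closed] by blast
    then have "?P u \<or> ?P v" using nz by fastforce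
    then have "size v = 0 \<or> size u = 0" using least size_mult[OF nz] uv by fastforce
    then show "u dvd 1 \<or> v dvd 1" using unit nz by blast
  qed
  \<comment> \<open>Some polynomial vanishes on \<open>Y\<close> but not on all of \<open>W\<close>.
    So \<open>p\<close> does not divide it, and \<open>Y\<close> lies in the finite set of their
    common zeros.\<close>
  obtain x where x: "x \<in> W" "x \<notin> Y" using Y by blast
  obtain g where g: "g \<in> poly_fun 2" "\<And>y. y \<in> Y \<Longrightarrow> g y = 0" "g x \<noteq> 0"
    by (rule zclosed_separate[OF Y(1) x(2) zclosed_length[OF zirreducible_closed[OF W] x(1)]])
      (rule that)
  obtain q where q: "\<And>y1 y2. g [y1, y2] = eval2 q y1 y2" by (rule poly_fun_2_eval2[OF g(1)]) (rule that)
  obtain x1 x2 where "x = [x1, x2]" using list2 x(1) by blast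
  then have "\<not> p dvd q" using p x(1) g(3) q eval2_dvd_zero by metis
  from finite_common_zeros[OF ac \<open>irreducible p\<close> this]
  have "finite ((\<lambda>(y1, y2). [y1, y2]) ` {(y1, y2). eval2 p y1 y2 = 0 \<and> eval2 q y1 y2 = 0})"
    by (rule finite_imageI)
  then show ?thesis
  proof (rule rev_finite_subset, intro subsetI)
    fix y assume y: "y \<in> Y"
    then obtain y1 y2 where "y = [y1, y2]" using list2 Y(2) by blast
    then show "y \<in> (\<lambda>(y1, y2). [y1, y2]) ` {(y1, y2). eval2 p y1 y2 = 0 \<and> eval2 q y1 y2 = 0}"
      using y Y(2) p g(2)[of y] q by force
  qed
qed

section \<open>Double covers and circles\<close>

lemma poly_param_eval2:
  fixes g :: "'a::comm_ring_1 poly poly"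
  shows "\<exists>r. \<forall>t. poly r t = eval2 g (poly u t) (poly v t)"
proof -
  have "(\<lambda>t. eval2 g (poly u t) (poly v t)) \<in> range poly"
  proof (rule eval2_closure)
    show "(\<lambda>_. c) \<in> range poly" for c :: 'a by (auto intro!: image_eqI[of _ _ "[:c:]"])
    show "(\<lambda>x. g x + h x) \<in> range poly" if "g \<in> range poly" "h \<in> range poly" for g h :: "'a \<Rightarrow> 'a"
      using that by (auto intro!: image_eqI[of _ _ "_ + _"])
    show "(\<lambda>x. g x * h x) \<in> range poly" if "g \<in> range poly" "h \<in> range poly" for g h :: "'a \<Rightarrow> 'a"
      using that by (auto intro!: image_eqI[of _ _ "_ * _"] simp: poly_mult)
  qed auto
  then show ?thesis by (metis (no_types, lifting) imageE)
qed

text \<open>Functions on the double cover \<open>t\<^sup>2 N = e\<close> of the plane which, up to a power of N, are of the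
  form P + tQ with P and Q polynomials on the plane.\<close>
definition double_cover_fun :: "'a::comm_ring_1 poly poly \<Rightarrow> 'a \<Rightarrow> ('a \<times> 'a \<times> 'a \<Rightarrow> 'a) set" where
  "double_cover_fun N e = {G. \<exists>k p q. \<forall>y1 y2 t. t\<^sup>2 * eval2 N y1 y2 = e \<longrightarrow>
     eval2 N y1 y2 ^ k * G (y1, y2, t) = eval2 p y1 y2 + t * eval2 q y1 y2}"

lemma double_cover_funI:
  assumes "\<And>y1 y2 t. t\<^sup>2 * eval2 N y1 y2 = e \<Longrightarrow>
    eval2 N y1 y2 ^ k * G (y1, y2, t) = eval2 p y1 y2 + t * eval2 q y1 y2"
  shows "G \<in> double_cover_fun N e"
  using assms unfolding double_cover_fun_def by blast

lemma double_cover_funE: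
  assumes "G \<in> double_cover_fun N e"
  obtains k p q where "\<forall>y1 y2 t. t\<^sup>2 * eval2 N y1 y2 = e \<longrightarrow>
    eval2 N y1 y2 ^ k * G (y1, y2, t) = eval2 p y1 y2 + t * eval2 q y1 y2"
  using assms unfolding double_cover_fun_def by blast

lemma double_cover_fun_eval2: "(\<lambda>(y1, y2, t). eval2 p y1 y2) \<in> double_cover_fun N e"
  by (rule double_cover_funI[of _ _ 0 _ p 0]) simp

lemma double_cover_fun_const: "(\<lambda>_. c) \<in> double_cover_fun N e"
  using double_cover_fun_eval2[of "[:[:c:]:]"] by (simp add: case_prod_unfold)

lemma double_cover_fun_y1: "(\<lambda>(y1, y2, t). y1) \<in> double_cover_fun N e"
  using double_cover_fun_eval2[of "[:0, 1:]"] by simp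

lemma double_cover_fun_y2: "(\<lambda>(y1, y2, t). y2) \<in> double_cover_fun N e"
  using double_cover_fun_eval2[of "[:[:0, 1:]:]"] by simp

lemma double_cover_fun_t: "(\<lambda>(y1, y2, t). t) \<in> double_cover_fun N e"
  by (rule double_cover_funI[of _ _ 0 _ 0 1]) simp

lemma double_cover_fun_add:
  assumes "G \<in> double_cover_fun N e" "H \<in> double_cover_fun N e"
  shows "(\<lambda>x. G x + H x) \<in> double_cover_fun N e"
proof -
  obtain k p q where G: "\<forall>y1 y2 t. t\<^sup>2 * eval2 N y1 y2 = e \<longrightarrow>
      eval2 N y1 y2 ^ k * G (y1, y2, t) = eval2 p y1 y2 + t * eval2 q y1 y2"
    using double_cover_funE[OF assms(1)] .
  obtain l r s where H: "\<forall>y1 y2 t. t\<^sup>2 * eval2 N y1 y2 = e \<longrightarrow>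
      eval2 N y1 y2 ^ l * H (y1, y2, t) = eval2 r y1 y2 + t * eval2 s y1 y2"
    using double_cover_funE[OF assms(2)] .
  have "eval2 N y1 y2 ^ (k + l) * (G (y1, y2, t) + H (y1, y2, t)) =
      eval2 (N ^ l * p + N ^ k * r) y1 y2 + t * eval2 (N ^ l * q + N ^ k * s) y1 y2"
    if "t\<^sup>2 * eval2 N y1 y2 = e" for y1 y2 t
  proof -
    have "eval2 N y1 y2 ^ (k + l) * (G (y1, y2, t) + H (y1, y2, t)) =
      eval2 N y1 y2 ^ l * (eval2 N y1 y2 ^ k * G (y1, y2, t)) +
      eval2 N y1 y2 ^ k * (eval2 N y1 y2 ^ l * H (y1, y2, t))"
      by (simp add: power_add algebra_simps)
    then show ?thesis unfolding G[rule_format, OF that] H[rule_format, OF that] by (simp add: algebra_simps)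
  qed
  then show ?thesis by (rule double_cover_funI)
qed

lemma double_cover_fun_mult:
  assumes "G \<in> double_cover_fun N e" "H \<in> double_cover_fun N e"
  shows "(\<lambda>x. G x * H x) \<in> double_cover_fun N e"
proof -
  obtain k p q where G: "\<forall>y1 y2 t. t\<^sup>2 * eval2 N y1 y2 = e \<longrightarrow>
      eval2 N y1 y2 ^ k * G (y1, y2, t) = eval2 p y1 y2 + t * eval2 q y1 y2"
    using double_cover_funE[OF assms(1)] .
  obtain l r s where H: "\<forall>y1 y2 t. t\<^sup>2 * eval2 N y1 y2 = e \<longrightarrow>
      eval2 N y1 y2 ^ l * H (y1, y2, t) = eval2 r y1 y2 + t * eval2 s y1 y2"
    using double_cover_funE[OF assms(2)] .
  \<comment> \<open>One power of \<open>N\<close> beyond k + l is spent on rewriting the t^2 in the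
    product by the relation t^2 N = e.\<close>
  have "eval2 N y1 y2 ^ (Suc (k + l)) * (G (y1, y2, t) * H (y1, y2, t)) =
      eval2 (N * p * r + [:[:e:]:] * q * s) y1 y2 + t * eval2 (N * (p * s + q * r)) y1 y2"
    if t: "t\<^sup>2 * eval2 N y1 y2 = e" for y1 y2 t
  proof -
    have "eval2 N y1 y2 ^ (Suc (k + l)) * (G (y1, y2, t) * H (y1, y2, t)) =
      eval2 N y1 y2 * ((eval2 N y1 y2 ^ k * G (y1, y2, t)) * (eval2 N y1 y2 ^ l * H (y1, y2, t)))"
      by (simp add: power_add algebra_simps)
    then show ?thesis
      unfolding G[rule_format, OF t] H[rule_format, OF t]
      by (simp add: t[symmetric] power2_eq_square algebra_simps)
  qed
  then show ?thesis by (rule double_cover_funI)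
qed

text \<open>Changing the sign of t preserves t^2 N = e and turns P + tQ into P - tQ. The product has
  no linear term in t, and one extra factor N makes it N P^2 - e Q^2.\<close>

lemma double_cover_norm:
  assumes "G \<in> double_cover_fun N e"
  obtains k h where "\<forall>y1 y2 t. t\<^sup>2 * eval2 N y1 y2 = e \<longrightarrow>
    eval2 h y1 y2 = eval2 N y1 y2 ^ k * (G (y1, y2, t) * G (y1, y2, - t))"
proof -
  obtain k p q where G: "\<forall>y1 y2 t. t\<^sup>2 * eval2 N y1 y2 = e \<longrightarrow>
      eval2 N y1 y2 ^ k * G (y1, y2, t) = eval2 p y1 y2 + t * eval2 q y1 y2"
    using double_cover_funE[OF assms] .
  have "eval2 (N * p * p - [:[:e:]:] * q * q) y1 y2 =
      eval2 N y1 y2 ^ Suc (k + k) * (G (y1, y2, t) * G (y1, y2, - t))"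
    if t: "t\<^sup>2 * eval2 N y1 y2 = e" for y1 y2 t
  proof -
    have "eval2 N y1 y2 ^ (Suc (k + k)) * (G (y1, y2, t) * G (y1, y2, - t)) =
      eval2 N y1 y2 * ((eval2 N y1 y2 ^ k * G (y1, y2, t)) * (eval2 N y1 y2 ^ k * G (y1, y2, - t)))"
      by (simp add: power_add algebra_simps)
    moreover have "eval2 N y1 y2 ^ k * G (y1, y2, - t) = eval2 p y1 y2 + - t * eval2 q y1 y2"
      using G[rule_format, of "- t"] t by simp
    ultimately show ?thesis
      unfolding G[rule_format, OF t]
      by (simp add: t[symmetric] power2_eq_square algebra_simps)
  qed
  then show thesis using that by blast
qed

section \<open>The squared distance and the rational parametrisation of the circle\<close>

definition dist2_poly :: "'a::comm_ring_1 \<Rightarrow> 'a \<Rightarrow> 'a poly poly" where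
  "dist2_poly a b = [:[:a\<^sup>2 + b\<^sup>2, - 2 * b, 1:], [:- 2 * a:], 1:]"

lemma eval2_dist2_poly [simp]: "eval2 (dist2_poly a b) y1 y2 = (y1 - a)\<^sup>2 + (y2 - b)\<^sup>2"
  by (simp add: dist2_poly_def power2_eq_square algebra_simps)

lemma sqrt_exists:
  fixes c :: "'a::field"
  assumes "alg_closed TYPE('a)"
  obtains r where "r\<^sup>2 = c"
proof -
  have "degree [:- c, 0, 1:] > 0" by simp
  then obtain r where "poly [:- c, 0, 1:] r = 0" using assms unfolding alg_closed_def by blast
  then have "r\<^sup>2 = c" by (simp add: power2_eq_square)
  then show thesis by (rule that)
qed

text \<open>The circle is the image of the rational curve
  \<open>u \<mapsto> (a + (u + d\<^sup>2/u)/2, b + (u - d\<^sup>2/u)/(2i))\<close>, so a polynomial with infinitely many zeros on it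
  pulls back to a Laurent polynomial that is zero.\<close>
lemma vanish_on_circle:
  fixes g :: "'a::field_char_0 poly poly"
  assumes ac: "alg_closed TYPE('a)" and d: "d \<noteq> 0"
    and inf: "infinite {(y1, y2). (y1 - a)\<^sup>2 + (y2 - b)\<^sup>2 = d\<^sup>2 \<and> eval2 g y1 y2 = 0}" (is "infinite ?Z")
    and circ: "(z1 - a)\<^sup>2 + (z2 - b)\<^sup>2 = d\<^sup>2"
  shows "eval2 g z1 z2 = 0"
proof -
  obtain i :: 'a where i: "i\<^sup>2 = - 1" using sqrt_exists[OF ac] .
  then have ii: "i * i = - 1" by (simp add: power2_eq_square)
  have i0: "i \<noteq> 0" using i by auto
  define P where "P = (\<lambda>u::'a. a + (u + d\<^sup>2 / u) / 2)"
  define Q where "Q = (\<lambda>u::'a. b + (u - d\<^sup>2 / u) / (2 * i))"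
  have param: "\<exists>u. u \<noteq> 0 \<and> y1 = P u \<and> y2 = Q u" if y: "(y1 - a)\<^sup>2 + (y2 - b)\<^sup>2 = d\<^sup>2" for y1 y2
  proof -
    \<comment> \<open>In these isotropic coordinates the circle becomes the hyperbola u v = d^2, so
      that u determines v.\<close>
    define u where "u = (y1 - a) + i * (y2 - b)"
    define v where "v = (y1 - a) - i * (y2 - b)"
    have "u * v = (y1 - a)\<^sup>2 - i\<^sup>2 * (y2 - b)\<^sup>2"
      by (simp add: u_def v_def power2_eq_square algebra_simps)
    then have uv: "u * v = d\<^sup>2" using i y by simp
    then have "u \<noteq> 0" using d by auto
    then have "d\<^sup>2 / u = v" using uv by (simp add: field_simps)
    then have P: "P u = a + (u + v) / 2" and Q: "Q u = b + (u - v) / (2 * i)"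
      by (simp_all add: P_def Q_def)
    have uv: "u + v = 2 * (y1 - a)" "u - v = 2 * i * (y2 - b)"
      by (simp_all add: u_def v_def algebra_simps)
    have "y1 = P u" unfolding P uv by (subst nonzero_mult_div_cancel_left) simp_all
    moreover have "y2 = Q u" unfolding Q uv using i0 by (subst nonzero_mult_div_cancel_left) simp_all
    ultimately have "y1 = P u" "y2 = Q u" .
    then show ?thesis using \<open>u \<noteq> 0\<close> by blast
  qed
  \<comment> \<open>Laurent polynomials in u, regarded as functions away from 0.\<close>
  let ?R = "{h. \<exists>k r. \<forall>u::'a. u \<noteq> 0 \<longrightarrow> u ^ k * h u = poly r u}"
  have "(\<lambda>u. eval2 g (P u) (Q u)) \<in> ?R"
  proof (rule eval2_closure)
    show "(\<lambda>_. c) \<in> ?R" for c by (auto intro!: exI[of _ 0] exI[of _ "[:c:]"])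
    show "(\<lambda>x. g x + h x) \<in> ?R" if gh: "g \<in> ?R" "h \<in> ?R" for g h
    proof -
      obtain k p l q where g: "\<And>u. u \<noteq> 0 \<Longrightarrow> u ^ k * g u = poly p u"
        and h: "\<And>u. u \<noteq> 0 \<Longrightarrow> u ^ l * h u = poly q u"
        using gh by auto
      have "u ^ (k + l) * (g u + h u) = poly (monom 1 l * p + monom 1 k * q) u" if "u \<noteq> 0" for u
        using that by (simp add: poly_monom power_add algebra_simps flip: g h)
      then show ?thesis by blast
    qed
    show "(\<lambda>x. g x * h x) \<in> ?R" if gh: "g \<in> ?R" "h \<in> ?R" for g h
    proof -
      obtain k p l q where g: "\<And>u. u \<noteq> 0 \<Longrightarrow> u ^ k * g u = poly p u"
        and h: "\<And>u. u \<noteq> 0 \<Longrightarrow> u ^ l * h u = poly q u"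
        using gh by auto
      have "u ^ (k + l) * (g u * h u) = poly (p * q) u" if "u \<noteq> 0" for u
        using that by (simp add: poly_mult power_add algebra_simps flip: g h)
      then show ?thesis by blast
    qed
    show "P \<in> ?R"
      by (auto intro!: exI[of _ 1] exI[of _ "[:d\<^sup>2 / 2, a, 1 / 2:]"] simp: P_def field_simps)
    show "Q \<in> ?R"
      using i0 by (auto intro!: exI[of _ 1] exI[of _ "[:- d\<^sup>2 / (2 * i), b, 1 / (2 * i):]"] simp: Q_def field_simps)
  qed
  then obtain k r where r: "\<And>u. u \<noteq> 0 \<Longrightarrow> u ^ k * eval2 g (P u) (Q u) = poly r u" by auto
  have sub: "?Z \<subseteq> (\<lambda>u. (P u, Q u)) ` {u. poly r u = 0}"
  proof clarify
    fix y1 y2 assume y: "(y1 - a)\<^sup>2 + (y2 - b)\<^sup>2 = d\<^sup>2" "eval2 g y1 y2 = 0"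
    then obtain u where "u \<noteq> 0" "y1 = P u" "y2 = Q u" using param by blast
    then show "(y1, y2) \<in> (\<lambda>u. (P u, Q u)) ` {u. poly r u = 0}" using r[of u] y(2) by auto
  qed
  have "r = 0"
  proof (rule ccontr)
    assume "r \<noteq> 0"
    then have "finite ((\<lambda>u. (P u, Q u)) ` {u. poly r u = 0})"
      by (intro finite_imageI poly_roots_finite)
    from finite_subset[OF sub this] show False using inf by contradiction
  qed
  obtain u where "u \<noteq> 0" "z1 = P u" "z2 = Q u" using param[OF circ] by blast
  then show ?thesis using r[of u] \<open>r = 0\<close> by simp
qed

section \<open>Conchoids\<close>

lemma finite_square_solutions:
  fixes c e :: "'a::idom"
  assumes "e \<noteq> 0"
  shows "finite {t. t\<^sup>2 * c = e}"
proof -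
  have "[:- e, 0, c:] \<noteq> 0" using assms by simp
  from poly_roots_finite[OF this] show ?thesis
    by (rule rev_finite_subset) (auto simp: power2_eq_square algebra_simps)
qed

section \<open>The double cover and its involution\<close>

definition cover_point :: "'a::field \<Rightarrow> 'a \<Rightarrow> 'a \<Rightarrow> 'a \<times> 'a \<times> 'a \<Rightarrow> 'a list" where
  "cover_point a b d = (\<lambda>(y1, y2, t).
     [y1 + t * (y1 - a), y2 + t * (y2 - b), y1, y2, t\<^sup>2 / d\<^sup>2])"

text \<open>Expressed through x, y and w instead of t, so that it is a linear map on K^5 and
  polynomial arguments apply to it.\<close>

definition flip :: "'a::comm_ring_1 list \<Rightarrow> 'a list" where
  "flip x = [2 * x ! 2 - x ! 0, 2 * x ! 3 - x ! 1, x ! 2, x ! 3, x ! 4]"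

lemma Bset_eq_cover:
  fixes a b d :: "'a::field"
  assumes d: "d \<noteq> 0"
  shows "Bset f a b d = cover_point a b d `
    {(y1, y2, t). eval2 f y1 y2 = 0 \<and> t\<^sup>2 * ((y1 - a)\<^sup>2 + (y2 - b)\<^sup>2) = d\<^sup>2}" (is "_ = _ ` ?D")
proof (intro subset_antisym subsetI)
  fix x assume "x \<in> Bset f a b d"
  then obtain x1 x2 y1 y2 w where x: "x = [x1, x2, y1, y2, w]" "eval2 f y1 y2 = 0"
    and dist: "(x1 - y1)\<^sup>2 + (x2 - y2)\<^sup>2 = d\<^sup>2"
    and par: "(y2 - b) * (x1 - y1) - (y1 - a) * (x2 - y2) = 0"
    and w: "w * ((y1 - a)\<^sup>2 + (y2 - b)\<^sup>2) = 1"
    unfolding Bset_def by auto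
  \<comment> \<open>\<open>t\<close> is the coefficient of the orthogonal projection of x - y to y -
    A, with \<open>w\<close> as the inverse of the squared length of y - A. Parallelism makes the
    projection equal to x - y.\<close>
  define p q t where "p = y1 - a" and "q = y2 - b" and "t = w * ((x1 - y1) * p + (x2 - y2) * q)"
  have pq: "q * (x1 - y1) = p * (x2 - y2)" "w * (p\<^sup>2 + q\<^sup>2) = 1"
    using par w by (simp_all add: p_def q_def)
  have "t * p = w * (p\<^sup>2 * (x1 - y1) + p * (x2 - y2) * q)"
    by (simp add: t_def power2_eq_square algebra_simps)
  also have "\<dots> = (w * (p\<^sup>2 + q\<^sup>2)) * (x1 - y1)"
    unfolding pq(1)[symmetric] by (simp add: power2_eq_square algebra_simps)
  finally have tp: "t * p = x1 - y1" using pq by simp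
  have "t * q = w * (q\<^sup>2 * (x2 - y2) + q * (x1 - y1) * p)"
    by (simp add: t_def power2_eq_square algebra_simps)
  also have "\<dots> = (w * (p\<^sup>2 + q\<^sup>2)) * (x2 - y2)"
    unfolding pq(1) by (simp add: power2_eq_square algebra_simps)
  finally have tq: "t * q = x2 - y2" using pq by simp
  have t: "t\<^sup>2 * (p\<^sup>2 + q\<^sup>2) = d\<^sup>2"
    unfolding dist[symmetric] tp[symmetric] tq[symmetric] by (simp add: power2_eq_square algebra_simps)
  have "w * d\<^sup>2 = t\<^sup>2 * (w * (p\<^sup>2 + q\<^sup>2))" unfolding t[symmetric] by (simp add: ac_simps)
  then have "w = t\<^sup>2 / d\<^sup>2" using pq d by (simp add: field_simps)
  then have "x = cover_point a b d (y1, y2, t)"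
    using tp tq by (simp add: x cover_point_def p_def q_def)
  moreover have "(y1, y2, t) \<in> ?D" using t x(2) by (simp add: p_def q_def)
  ultimately show "x \<in> cover_point a b d ` ?D" by blast
next
  fix x assume "x \<in> cover_point a b d ` ?D"
  then obtain y1 y2 t where x: "x = cover_point a b d (y1, y2, t)" "eval2 f y1 y2 = 0"
    and t: "t\<^sup>2 * ((y1 - a)\<^sup>2 + (y2 - b)\<^sup>2) = d\<^sup>2" by auto
  have "(t * (y1 - a))\<^sup>2 + (t * (y2 - b))\<^sup>2 = d\<^sup>2"
    unfolding t[symmetric] by (simp add: power2_eq_square algebra_simps)
  moreover have "(y2 - b) * (t * (y1 - a)) - (y1 - a) * (t * (y2 - b)) = 0" by (simp add: ac_simps)
  moreover have "t\<^sup>2 / d\<^sup>2 * ((y1 - a)\<^sup>2 + (y2 - b)\<^sup>2) = 1" using t d by simp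
  ultimately show "x \<in> Bset f a b d" using x by (simp add: Bset_def cover_point_def)
qed

lemma flip_cover_point: "flip (cover_point a b d (y1, y2, t)) = cover_point a b d (y1, y2, - t)"
  by (simp add: flip_def cover_point_def algebra_simps)

lemma flip_flip: "length x = 5 \<Longrightarrow> flip (flip x) = x"
  by (auto simp: flip_def numeral_eq_Suc length_Suc_conv)

lemma length_flip [simp]: "length (flip x) = 5"
  by (simp add: flip_def)

lemma less_5_cases: "(i::nat) < 5 \<Longrightarrow> i = 0 \<or> i = 1 \<or> i = 2 \<or> i = 3 \<or> i = 4"
  by auto

lemma flip_poly_fun:
  assumes "i < 5"
  shows "(\<lambda>x::'a::comm_ring_1 list. flip x ! i) \<in> poly_fun 5"
proof -
  have "(\<lambda>x::'a list. 2 * x ! 2 - x ! 0) \<in> poly_fun 5" "(\<lambda>x::'a list. 2 * x ! 3 - x ! 1) \<in> poly_fun 5"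
    by (intro poly_fun_diff poly_fun.mult poly_fun.const poly_fun.var; simp)+
  then show ?thesis
    using less_5_cases[OF assms] by (elim disjE) (simp_all add: flip_def poly_fun.var)
qed

text \<open>For an involution images are preimages, and \<open>zclosed_vimage\<close> shows that
  these are closed.\<close>

lemma flip_image_eq:
  assumes "X \<subseteq> affine_space 5"
  shows "flip ` X = {x \<in> affine_space 5. flip x \<in> X}"
  using assms flip_flip by (force simp: affine_space_def image_iff)

lemma zclosed_subset_affine: "zclosed n X \<Longrightarrow> X \<subseteq> affine_space n"
  by (auto simp: affine_space_def zclosed_length)

lemma zclosed_flip: "zclosed 5 X \<Longrightarrow> zclosed 5 (flip ` X)"
  unfolding flip_image_eq[OF zclosed_subset_affine]
  by (rule zclosed_vimage[OF _ length_flip flip_poly_fun])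

lemma zirreducible_flip: "zirreducible 5 X \<Longrightarrow> zirreducible 5 (flip ` X)"
  using zirreducible_zclosure_image[of 5 X flip 5, OF _ length_flip flip_poly_fun] zclosed_flip[of X]
  by (simp add: zclosure_eq zirreducible_closed)

lemma flip_image_image: "X \<subseteq> affine_space 5 \<Longrightarrow> flip ` flip ` X = X"
  using flip_flip by (force simp: affine_space_def image_iff)

lemma pi1_poly_fun:
  assumes "i < 2"
  shows "(\<lambda>x. pi1 x ! i) \<in> poly_fun 5"
proof -
  have "i = 0 \<or> i = 1" using assms by auto
  then show ?thesis by (elim disjE) (simp_all add: pi1_def poly_fun.var)
qed

lemma length_pi1 [simp]: "length (pi1 x) = 2"
  by (simp add: pi1_def)

lemma zclosed_Bset: "zclosed 5 (Bset f a b d)"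
proof (rule zclosedI)
  let ?S = "{\<lambda>x. eval2 f (x ! 2) (x ! 3),
    \<lambda>x. (x ! 0 - x ! 2)\<^sup>2 + (x ! 1 - x ! 3)\<^sup>2 - d\<^sup>2,
    \<lambda>x. (x ! 3 - b) * (x ! 0 - x ! 2) - (x ! 2 - a) * (x ! 1 - x ! 3),
    \<lambda>x. x ! 4 * ((x ! 2 - a)\<^sup>2 + (x ! 3 - b)\<^sup>2) - 1}"
  show "?S \<subseteq> poly_fun 5"
    unfolding insert_subset
    by (intro conjI empty_subsetI eval2_poly_fun poly_fun_diff poly_fun_power poly_fun.add
        poly_fun.mult poly_fun.const poly_fun.var) simp_all
  show "Bset f a b d = zero_set 5 ?S"
    by (auto simp: Bset_def in_zero_set numeral_eq_Suc length_Suc_conv)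
qed

text \<open>Away from A the construction is symmetric in x and y: \<open>1 + s\<close> is the inverse of \<open>1 + t\<close>.\<close>
lemma conchoid_inverse:
  fixes a b d :: "'a::field"
  assumes t: "t\<^sup>2 * ((y1 - a)\<^sup>2 + (y2 - b)\<^sup>2) = e" "t \<noteq> - 1"
    and x: "x1 = y1 + t * (y1 - a)" "x2 = y2 + t * (y2 - b)"
  obtains s where "s\<^sup>2 * ((x1 - a)\<^sup>2 + (x2 - b)\<^sup>2) = e" "y1 = x1 + s * (x1 - a)" "y2 = x2 + s * (x2 - b)"
proof -
  define s where "s = - t / (1 + t)"
  have "1 + t \<noteq> 0" using t(2) by (metis add.commute add_eq_0_iff)
  then have s: "s * (1 + t) = - t" by (simp add: s_def)
  have xa: "x1 - a = (1 + t) * (y1 - a)" "x2 - b = (1 + t) * (y2 - b)"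
    by (simp_all add: x algebra_simps)
  have "s\<^sup>2 * ((x1 - a)\<^sup>2 + (x2 - b)\<^sup>2) = (s * (1 + t))\<^sup>2 * ((y1 - a)\<^sup>2 + (y2 - b)\<^sup>2)"
    unfolding xa by (simp add: power2_eq_square algebra_simps)
  also have "\<dots> = e" unfolding s using t(1) by simp
  finally have *: "s\<^sup>2 * ((x1 - a)\<^sup>2 + (x2 - b)\<^sup>2) = e" .
  have "x1 + s * (x1 - a) = y1 + t * (y1 - a) + s * (1 + t) * (y1 - a)"
    "x2 + s * (x2 - b) = y2 + t * (y2 - b) + s * (1 + t) * (y2 - b)"
    unfolding xa by (simp_all add: x)
  then have "y1 = x1 + s * (x1 - a)" "y2 = x2 + s * (x2 - b)" unfolding s by simp_all
  with * show thesis by (rule that)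
qed

section \<open>The structure of B\<close>

locale conchoid_setup =
  fixes f :: "'a::field_char_0 poly poly" and a b d :: 'a
  assumes alg_closed: "alg_closed TYPE('a)"
    and irreducible: "irreducible f"
    and d_nonzero: "d \<noteq> 0"
    and C0_nonempty: "C0 f a b \<noteq> {}"
begin

abbreviation "B \<equiv> Bset f a b d"

lemmas B_cover = Bset_eq_cover[OF d_nonzero, of f a b]

lemma BE:
  assumes "x \<in> B"
  obtains y1 y2 t where "x = cover_point a b d (y1, y2, t)" "eval2 f y1 y2 = 0"
    "t\<^sup>2 * ((y1 - a)\<^sup>2 + (y2 - b)\<^sup>2) = d\<^sup>2"
  using assms unfolding B_cover by blast

lemma B_affine: "B \<subseteq> affine_space 5"
  by (rule zclosed_subset_affine[OF zclosed_Bset])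

lemma flip_B: "flip ` B = B"
proof -
  have "flip ` B \<subseteq> B"
  proof clarify
    fix x assume "x \<in> B"
    then obtain y1 y2 t where "x = cover_point a b d (y1, y2, t)" "eval2 f y1 y2 = 0"
      "t\<^sup>2 * ((y1 - a)\<^sup>2 + (y2 - b)\<^sup>2) = d\<^sup>2" by (rule BE)
    then show "flip x \<in> B" unfolding B_cover by (auto simp: flip_cover_point)
  qed
  moreover from this have "flip ` flip ` B \<subseteq> flip ` B" by blast
  ultimately show ?thesis using flip_image_image[OF B_affine] by blast
qed

text \<open>Nonemptiness of \<open>C0\<close> implies that \<open>f\<close> does not divide the
  squared distance to A. So only finitely many points of the infinite curve are lost, and over each
  of the others a square root provides a point of B.\<close>

lemma infinite_B: "infinite B"
proof -
  let ?N = "dist2_poly a b"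
  obtain z1 z2 where "eval2 f z1 z2 = 0" "eval2 ?N z1 z2 \<noteq> 0"
    using C0_nonempty by (auto simp: C0_def curve_def)
  then have "\<not> f dvd ?N" using eval2_dvd_zero by blast
  then have "finite {(y1, y2). eval2 f y1 y2 = 0 \<and> eval2 ?N y1 y2 = 0}"
    by (rule finite_common_zeros[OF alg_closed irreducible])
  then have "infinite ({(y1, y2). eval2 f y1 y2 = 0} - {(y1, y2). eval2 f y1 y2 = 0 \<and> eval2 ?N y1 y2 = 0})"
    (is "infinite ?S") by (rule Diff_infinite_finite[OF _ infinite_zeros[OF alg_closed irreducible]])
  moreover have "?S \<subseteq> (\<lambda>x. (x ! 2, x ! 3)) ` B"
  proof
    fix y assume "y \<in> ?S"
    then obtain y1 y2 where [simp]: "y = (y1, y2)" and y: "eval2 f y1 y2 = 0" "eval2 ?N y1 y2 \<noteq> 0"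
      by blast
    obtain t where "t\<^sup>2 = d\<^sup>2 / eval2 ?N y1 y2" using sqrt_exists[OF alg_closed] .
    then have "t\<^sup>2 * ((y1 - a)\<^sup>2 + (y2 - b)\<^sup>2) = d\<^sup>2" using y by simp
    then have "cover_point a b d (y1, y2, t) \<in> B" unfolding B_cover using y by blast
    then show "y \<in> (\<lambda>x. (x ! 2, x ! 3)) ` B"
      by (rule rev_image_eqI) (simp add: cover_point_def numeral_eq_Suc)
  qed
  ultimately show ?thesis using finite_subset finite_imageI by blast
qed

lemma finite_cover_over:
  assumes "finite S"
  shows "finite {x \<in> B. (x ! 2, x ! 3) \<in> S}"
proof -
  let ?T = "\<lambda>(y1, y2). {t. t\<^sup>2 * ((y1 - a)\<^sup>2 + (y2 - b)\<^sup>2) = d\<^sup>2}"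
  have "finite (?T y)" for y
  proof -
    obtain y1 y2 where y: "y = (y1, y2)" by force
    have "d\<^sup>2 \<noteq> 0" using d_nonzero by simp
    then show ?thesis unfolding y prod.case by (rule finite_square_solutions)
  qed
  then have "finite (\<Union>y\<in>S. (\<lambda>t. cover_point a b d (fst y, snd y, t)) ` ?T y)"
    using assms by blast
  then show ?thesis
  proof (rule rev_finite_subset, clarify)
    fix x assume x: "x \<in> B" and S: "(x ! 2, x ! 3) \<in> S"
    obtain y1 y2 t where y: "x = cover_point a b d (y1, y2, t)" "eval2 f y1 y2 = 0"
      "t\<^sup>2 * ((y1 - a)\<^sup>2 + (y2 - b)\<^sup>2) = d\<^sup>2" using BE[OF x] .
    then have "(y1, y2) \<in> S" using S by (simp add: cover_point_def numeral_eq_Suc)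
    moreover have "t \<in> ?T (y1, y2)" using y by simp
    ultimately show "x \<in> (\<Union>y\<in>S. (\<lambda>t. cover_point a b d (fst y, snd y, t)) ` ?T y)"
      using y(1) by force
  qed
qed

text \<open>The norm of a function on B is a polynomial on the curve, and it either vanishes
  identically or at finitely many points.\<close>
lemma finite_norm_zeros:
  assumes k: "k \<in> poly_fun 5" and p: "p \<in> B" "k p \<noteq> 0" "k (flip p) \<noteq> 0"
  shows "finite {x \<in> B. k x * k (flip x) = 0}"
proof -
  let ?N = "dist2_poly a b"
  let ?G = "\<lambda>z. k (cover_point a b d z)"
  have "?G \<in> double_cover_fun ?N (d\<^sup>2)"
  proof (rule poly_fun_closure[where \<phi> = "cover_point a b d" and R = "double_cover_fun ?N (d\<^sup>2)",
        OF k double_cover_fun_const double_cover_fun_add double_cover_fun_mult])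
    fix i :: nat assume "i < 5"
    note I = double_cover_fun_add double_cover_fun_mult double_cover_fun_const
      double_cover_fun_y1 double_cover_fun_y2 double_cover_fun_t
    have "(\<lambda>z. (case z of (y1, y2, t) \<Rightarrow> y1) + (case z of (y1, y2, t) \<Rightarrow> t) *
        ((case z of (y1, y2, t) \<Rightarrow> y1) + - a)) \<in> double_cover_fun ?N (d\<^sup>2)"
      "(\<lambda>z. (case z of (y1, y2, t) \<Rightarrow> y2) + (case z of (y1, y2, t) \<Rightarrow> t) *
        ((case z of (y1, y2, t) \<Rightarrow> y2) + - b)) \<in> double_cover_fun ?N (d\<^sup>2)"
      "(\<lambda>z. (case z of (y1, y2, t) \<Rightarrow> t) * (case z of (y1, y2, t) \<Rightarrow> t) * (1 / d\<^sup>2))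
        \<in> double_cover_fun ?N (d\<^sup>2)"
      by (rule I)+
    with I(4,5)[of ?N "d\<^sup>2"] show "(\<lambda>z. cover_point a b d z ! i) \<in> double_cover_fun ?N (d\<^sup>2)"
      using less_5_cases[OF \<open>i < 5\<close>]
      by (auto simp: cover_point_def case_prod_unfold numeral_eq_Suc power2_eq_square)
  qed
  then obtain m h where "\<forall>y1 y2 t. t\<^sup>2 * eval2 ?N y1 y2 = d\<^sup>2 \<longrightarrow>
      eval2 h y1 y2 = eval2 ?N y1 y2 ^ m * (?G (y1, y2, t) * ?G (y1, y2, - t))"
    by (rule double_cover_norm) (rule that)
  then have h: "eval2 h y1 y2 = ((y1 - a)\<^sup>2 + (y2 - b)\<^sup>2) ^ m * (k x * k (flip x))"
    if "t\<^sup>2 * ((y1 - a)\<^sup>2 + (y2 - b)\<^sup>2) = d\<^sup>2" "x = cover_point a b d (y1, y2, t)" for x y1 y2 t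
    using that by (simp add: flip_cover_point)
  obtain y1 y2 t where y: "p = cover_point a b d (y1, y2, t)" "eval2 f y1 y2 = 0"
    "t\<^sup>2 * ((y1 - a)\<^sup>2 + (y2 - b)\<^sup>2) = d\<^sup>2" using BE[OF p(1)] .
  \<comment> \<open>The power of the squared distance does no harm: at points of B it cannot vanish,
    because t^2 N = d^2 is nonzero.\<close>
  have "eval2 h y1 y2 \<noteq> 0" unfolding h[OF y(3,1)] using p y(3) d_nonzero by auto
  then have "\<not> f dvd h" using y(2) eval2_dvd_zero by blast
  from finite_cover_over[OF finite_common_zeros[OF alg_closed irreducible this]]
  show ?thesis
  proof (rule rev_finite_subset, clarify)
    fix x assume x: "x \<in> B" "k x * k (flip x) = 0"
    obtain y1 y2 t where y: "x = cover_point a b d (y1, y2, t)" "eval2 f y1 y2 = 0"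
      "t\<^sup>2 * ((y1 - a)\<^sup>2 + (y2 - b)\<^sup>2) = d\<^sup>2" using BE[OF x(1)] .
    have "eval2 h y1 y2 = 0" unfolding h[OF y(3,1)] using x(2) by simp
    then show "eval2 f (x ! 2) (x ! 3) = 0 \<and> eval2 h (x ! 2) (x ! 3) = 0"
      using y by (simp add: cover_point_def numeral_eq_Suc)
  qed
qed

text \<open>If \<open>W\<close> misses p and flip p, there are polynomial functions vanishing on
  \<open>W\<close>, one nonzero at p and one nonzero at flip p; one of them or their sum is nonzero
  at both. Its norm is nonzero at p and so has finitely many zeros, yet it vanishes on the infinite
  set \<open>W\<close>.\<close>

lemma infinite_closed_covers:
  assumes W: "zclosed 5 W" "W \<subseteq> B" "infinite W"
  shows "W \<union> flip ` W = B"
proof (intro subset_antisym Un_least)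
  show "W \<subseteq> B" by fact
  show "flip ` W \<subseteq> B" using W(2) flip_B by blast
  show "B \<subseteq> W \<union> flip ` W"
  proof (rule subsetI, rule ccontr)
    fix p assume p: "p \<in> B" "p \<notin> W \<union> flip ` W"
    then have "length p = 5" using B_affine by (auto simp: affine_space_def)
    then have notin: "p \<notin> W" "flip p \<notin> W" using p(2) flip_flip by force+
    obtain g where g: "g \<in> poly_fun 5" "\<And>y. y \<in> W \<Longrightarrow> g y = 0" "g p \<noteq> 0"
      by (rule zclosed_separate[OF W(1) notin(1) \<open>length p = 5\<close>]) (rule that)
    obtain h where h: "h \<in> poly_fun 5" "\<And>y. y \<in> W \<Longrightarrow> h y = 0" "h (flip p) \<noteq> 0"
      by (rule zclosed_separate[OF W(1) notin(2) length_flip]) (rule that)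
    have no: "k p = 0 \<or> k (flip p) = 0" if k: "k \<in> poly_fun 5" "\<And>y. y \<in> W \<Longrightarrow> k y = 0" for k
    proof (rule ccontr)
      assume "\<not> ?thesis"
      then have "finite {x \<in> B. k x * k (flip x) = 0}" (is "finite ?S")
        using finite_norm_zeros[OF k(1) p(1)] by blast
      moreover have "W \<subseteq> ?S" using W(2) k(2) by auto
      ultimately show False using W(3) finite_subset by blast
    qed
    have "g (flip p) = 0" using no[OF g(1,2)] g(3) by blast
    moreover have "h p = 0" using no[OF h(1,2)] h(3) by blast
    moreover have "g p + h p = 0 \<or> g (flip p) + h (flip p) = 0"
      using no[OF poly_fun.add[OF g(1) h(1)]] g(2) h(2) by simp
    ultimately show False using g(3) h(3) by simp
  qed
qed

text \<open>An infinite \<open>Y\<close> would cover B together with its flip, so irreducibility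
  puts \<open>Z\<close> inside the flip of \<open>Y\<close>. Then the flip of \<open>Z\<close> lies
  strictly inside \<open>Z\<close>, which is impossible for an involution.\<close>

lemma finite_proper_closed_subset:
  assumes Z: "zirreducible 5 Z" "Z \<subseteq> B" and Y: "zclosed 5 Y" "Y \<subset> Z"
  shows "finite Y"
proof (rule ccontr)
  assume "infinite Y"
  then have "Y \<union> flip ` Y = B" using infinite_closed_covers Y Z(2) by blast
  then have "Z \<subseteq> flip ` Y"
    using zirreducible_subset_Un[OF Z(1) Y(1) zclosed_flip[OF Y(1)]] Z(2) Y(2) by blast
  then have "flip ` Z \<subseteq> flip ` flip ` Y" by blast
  then have "flip ` Z \<subseteq> Y" using flip_image_image[OF zclosed_subset_affine[OF Y(1)]] by simp
  then have "flip ` Z \<subset> Z" using Y(2) by blast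
  moreover from this have "flip ` flip ` Z \<subseteq> flip ` Z" by blast
  then have "Z \<subseteq> flip ` Z"
    using flip_image_image[OF zclosed_subset_affine[OF zirreducible_closed[OF Z(1)]]] by simp
  ultimately show False by blast
qed

text \<open>If B is reducible, a proper infinite closed subset Y with the fewest points in common with
  its flip is irreducible, since the points removed when passing to a smaller infinite closed
  subset are such common points.\<close>
lemma irreducible_half:
  obtains Y where "zirreducible 5 Y" "infinite Y" "Y \<union> flip ` Y = B"
proof (cases "\<exists>Y. zclosed 5 Y \<and> Y \<subset> B \<and> infinite Y")
  case False
  have "zirreducible 5 B"
    unfolding zirreducible_def
  proof (intro conjI allI impI)
    show "zclosed 5 B" by (rule zclosed_Bset)
    show "B \<noteq> {}" using infinite_B by auto
    fix Y Z assume YZ: "zclosed 5 Y \<and> zclosed 5 Z \<and> B = Y \<union> Z"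
    then have "infinite Y \<or> infinite Z" using infinite_B by (metis finite_Un)
    then show "B = Y \<or> B = Z" using False YZ by blast
  qed
  then show thesis using that[of B] infinite_B flip_B by simp
next
  case True
  let ?P = "\<lambda>Y. zclosed 5 Y \<and> Y \<subset> B \<and> infinite Y"
  obtain Y0 where "?P Y0" using True by blast
  then obtain Y where Y: "?P Y"
    and least: "\<And>Y'. ?P Y' \<Longrightarrow> card (Y \<inter> flip ` Y) \<le> card (Y' \<inter> flip ` Y')"
    using ex_has_least_nat[of ?P Y0 "\<lambda>Y. card (Y \<inter> flip ` Y)"] by blast
  have Y_aff: "Y \<subseteq> affine_space 5" using Y zclosed_subset_affine by blast
  have fin: "finite (Y \<inter> flip ` Y)"
  proof (rule ccontr)
    assume inf: "infinite (Y \<inter> flip ` Y)"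
    \<comment> \<open>The intersection is stable under \<open>flip\<close>; if infinite, it would
      cover B by itself and \<open>Y\<close> would not be proper.\<close>
    have "flip ` (Y \<inter> flip ` Y) \<subseteq> Y \<inter> flip ` Y"
      using image_Int_subset[of flip Y "flip ` Y"] flip_image_image[OF Y_aff]
      by (simp add: Int_commute)
    moreover have "(Y \<inter> flip ` Y) \<union> flip ` (Y \<inter> flip ` Y) = B"
      using Y inf by (intro infinite_closed_covers zclosed_Int zclosed_flip) auto
    ultimately have "B = Y \<inter> flip ` Y" by (simp add: Un_absorb2)
    then have "B \<subseteq> Y" by (metis Int_lower1)
    then show False using Y by (simp add: psubset_eq subset_antisym)
  qed
  have minimal: "Y' = Y" if Y': "zclosed 5 Y'" "Y' \<subseteq> Y" "infinite Y'" for Y'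
  proof (rule ccontr)
    assume "Y' \<noteq> Y"
    then obtain p where p: "p \<in> Y" "p \<notin> Y'" using Y' by blast
    have cov: "Y' \<union> flip ` Y' = B" using Y' Y by (intro infinite_closed_covers) auto
    then have "p \<in> flip ` Y'" using p Y by blast
    then have "p \<in> Y \<inter> flip ` Y" "p \<notin> Y' \<inter> flip ` Y'" using p Y' by blast+
    moreover have "Y' \<inter> flip ` Y' \<subseteq> Y \<inter> flip ` Y" using Y' by blast
    ultimately have "card (Y' \<inter> flip ` Y') < card (Y \<inter> flip ` Y)"
      by (intro psubset_card_mono[OF fin]) blast
    moreover have "?P Y'" using Y' Y by blast
    ultimately show False using least by fastforce
  qed
  have "zirreducible 5 Y"
    unfolding zirreducible_def
  proof (intro conjI allI impI)
    show "zclosed 5 Y" "Y \<noteq> {}" using Y by auto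
    fix U V assume UV: "zclosed 5 U \<and> zclosed 5 V \<and> Y = U \<union> V"
    then have "infinite U \<or> infinite V" using Y by (metis finite_Un)
    then show "Y = U \<or> Y = V" using minimal UV by blast
  qed
  moreover have "Y \<union> flip ` Y = B" using Y by (intro infinite_closed_covers) auto
  ultimately show thesis using that Y by blast
qed

section \<open>The projection to the plane\<close>

lemma vanishing_on_projection:
  obtains h where "h \<noteq> 0" "\<forall>x\<in>B. eval2 h (x ! 0) (x ! 1) = 0"
proof -
  \<comment> \<open>Here the coordinates (y1, y2, t) of the double cover stand for x1, x2 and the
    parameter s of \<open>conchoid_inverse\<close>; \<open>?u\<close> and \<open>?v\<close> recover
    y.\<close>
  let ?M = "dist2_poly a b"
  let ?R = "double_cover_fun ?M (d\<^sup>2)"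
  let ?u = "\<lambda>z. (case z of (y1, y2, t) \<Rightarrow> y1) + (case z of (y1, y2, t) \<Rightarrow> t) *
        ((case z of (y1, y2, t) \<Rightarrow> y1) + - a)"
  let ?v = "\<lambda>z. (case z of (y1, y2, t) \<Rightarrow> y2) + (case z of (y1, y2, t) \<Rightarrow> t) *
        ((case z of (y1, y2, t) \<Rightarrow> y2) + - b)"
  have uv: "?u \<in> ?R" "?v \<in> ?R"
    by (rule double_cover_fun_add double_cover_fun_mult double_cover_fun_const
      double_cover_fun_y1 double_cover_fun_y2 double_cover_fun_t)+
  have "(\<lambda>z. eval2 f (?u z) (?v z)) \<in> ?R"
    by (rule eval2_closure[where R = ?R,
          OF double_cover_fun_const double_cover_fun_add double_cover_fun_mult uv])
  then obtain m h where "\<forall>y1 y2 t. t\<^sup>2 * eval2 ?M y1 y2 = d\<^sup>2 \<longrightarrow>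
      eval2 h y1 y2 = eval2 ?M y1 y2 ^ m *
        (eval2 f (?u (y1, y2, t)) (?v (y1, y2, t)) * eval2 f (?u (y1, y2, - t)) (?v (y1, y2, - t)))"
    by (rule double_cover_norm) (rule that)
  then have h: "eval2 h x1 x2 = ((x1 - a)\<^sup>2 + (x2 - b)\<^sup>2) ^ m *
      (eval2 f (x1 + s * (x1 - a)) (x2 + s * (x2 - b)) *
       eval2 f (x1 - s * (x1 - a)) (x2 - s * (x2 - b)))"
    if "s\<^sup>2 * ((x1 - a)\<^sup>2 + (x2 - b)\<^sup>2) = d\<^sup>2" for x1 x2 s
    using that by simp
  \<comment> \<open>The factor \<open>?M\<close> disposes of x = A, where t = -1 and y cannot be
    recovered. Nonvanishing is tested on a line through A that has a non-isotropic direction and is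
    not contained in the curve.\<close>
  have "h * ?M \<noteq> 0"
  proof -
    have "irreducible f" by (rule irreducible)
    then have "f \<noteq> 0" by auto
    moreover have "?M \<noteq> 0" by (simp add: dist2_poly_def)
    ultimately have "f * ?M \<noteq> 0" by simp
    then obtain y1 y2 where "eval2 (f * ?M) y1 y2 \<noteq> 0" by (rule eval2_nonzero_point)
    then have y: "eval2 f y1 y2 \<noteq> 0" "(y1 - a)\<^sup>2 + (y2 - b)\<^sup>2 \<noteq> 0" by auto
    define \<alpha> \<beta> where "\<alpha> = y1 - a" and "\<beta> = y2 - b"
    obtain r where r: "r\<^sup>2 = \<alpha>\<^sup>2 + \<beta>\<^sup>2" using sqrt_exists[OF alg_closed] .
    have r0: "r \<noteq> 0" using r y(2) by (auto simp: \<alpha>_def \<beta>_def)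
    \<comment> \<open>The direction has squared length r^2, so shifting the parameter by \<delta>
      moves a point by distance d along the line.\<close>
    define \<delta> where "\<delta> = d / r"
    obtain \<phi> where \<phi>: "\<forall>t. poly \<phi> t = eval2 f (poly [:a, \<alpha>:] t) (poly [:b, \<beta>:] t)"
      using poly_param_eval2 by blast
    have "poly \<phi> 1 \<noteq> 0" using y(1) unfolding \<phi>[rule_format] by (simp add: \<alpha>_def \<beta>_def)
    then have "finite {t. poly \<phi> t = 0}" by (intro poly_roots_finite) auto
    \<comment> \<open>The parameter l has to avoid 0, which belongs to A, and the roots of
      \<open>\<phi>\<close> shifted by \<delta> either way, so that \<open>f\<close> is nonzero at
      both candidates for y.\<close>
    then have "finite (insert 0 ((\<lambda>t. t - \<delta>) ` {t. poly \<phi> t = 0} \<union> (\<lambda>t. t + \<delta>) ` {t. poly \<phi> t = 0}))"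
      (is "finite ?S") by simp
    then obtain l where l: "l \<notin> ?S" using ex_new_if_finite[OF infinite_UNIV_char_0] by blast
    then have "l \<noteq> 0" by simp
    have "poly \<phi> (l + \<delta>) \<noteq> 0" using l by (auto simp: image_iff)
    moreover have "poly \<phi> (l - \<delta>) \<noteq> 0" using l by (auto simp: image_iff)
    ultimately have nz: "eval2 f (a + (l + \<delta>) * \<alpha>) (b + (l + \<delta>) * \<beta>) \<noteq> 0"
      "eval2 f (a + (l - \<delta>) * \<alpha>) (b + (l - \<delta>) * \<beta>) \<noteq> 0"
      by (simp_all add: \<phi>)
    define x1 x2 s where "x1 = a + l * \<alpha>" and "x2 = b + l * \<beta>" and "s = \<delta> / l"
    have M: "(x1 - a)\<^sup>2 + (x2 - b)\<^sup>2 = l\<^sup>2 * r\<^sup>2"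
      unfolding r by (simp add: x1_def x2_def power2_eq_square algebra_simps)
    have sl: "s * l = \<delta>" using \<open>l \<noteq> 0\<close> by (simp add: s_def)
    have "s\<^sup>2 * (l\<^sup>2 * r\<^sup>2) = (s * l * r)\<^sup>2" by (simp add: power_mult_distrib)
    also have "\<dots> = d\<^sup>2" using r0 by (simp add: sl \<delta>_def)
    finally have "s\<^sup>2 * ((x1 - a)\<^sup>2 + (x2 - b)\<^sup>2) = d\<^sup>2" unfolding M .
    note h = h[OF this]
    have e: "s * (x1 - a) = \<delta> * \<alpha>" "s * (x2 - b) = \<delta> * \<beta>"
      by (simp_all add: x1_def x2_def sl[symmetric])
    have "x1 + s * (x1 - a) = a + (l + \<delta>) * \<alpha>" "x2 + s * (x2 - b) = b + (l + \<delta>) * \<beta>"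
      "x1 - s * (x1 - a) = a + (l - \<delta>) * \<alpha>" "x2 - s * (x2 - b) = b + (l - \<delta>) * \<beta>"
      unfolding e by (simp_all add: x1_def x2_def algebra_simps)
    with h nz have "eval2 h x1 x2 \<noteq> 0" using M \<open>l \<noteq> 0\<close> r0 by simp
    then have "eval2 (h * ?M) x1 x2 \<noteq> 0" using M \<open>l \<noteq> 0\<close> r0 by simp
    then show ?thesis by fastforce
  qed
  moreover have "eval2 (h * ?M) (x ! 0) (x ! 1) = 0" if x: "x \<in> B" for x
  proof -
    obtain y1 y2 t where y: "x = cover_point a b d (y1, y2, t)" "eval2 f y1 y2 = 0"
      "t\<^sup>2 * ((y1 - a)\<^sup>2 + (y2 - b)\<^sup>2) = d\<^sup>2" using BE[OF x] .
    have x01: "x ! 0 = y1 + t * (y1 - a)" "x ! 1 = y2 + t * (y2 - b)"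
      by (simp_all add: y(1) cover_point_def)
    show ?thesis
    proof (cases "t = - 1")
      case True
      then show ?thesis using x01 by simp
    next
      case False
      obtain s where s: "s\<^sup>2 * ((x ! 0 - a)\<^sup>2 + (x ! 1 - b)\<^sup>2) = d\<^sup>2"
        "y1 = x ! 0 + s * (x ! 0 - a)" "y2 = x ! 1 + s * (x ! 1 - b)"
        using conchoid_inverse[OF y(3) False x01] .
      have "eval2 h (x ! 0) (x ! 1) = 0" unfolding h[OF s(1)] s(2,3)[symmetric] y(2) by simp
      then show ?thesis by simp
    qed
  qed
  ultimately show thesis using that by blast
qed

text \<open>A point other than A comes from finitely many y only, one for each admissible s, so an
  infinite \<open>Y\<close> can project only to A. In that case (1 + t)(y - A) = 0 forces t = -1,
  and infinitely many points of the curve lie on the circle.\<close>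

lemma projection_constant_imp_circle:
  assumes Y: "Y \<subseteq> B" "infinite Y" and const: "pi1 ` Y \<subseteq> {[p1, p2]}"
  shows "curve f = circle a b d"
proof -
  have coords: "\<exists>t. eval2 f (x ! 2) (x ! 3) = 0 \<and> t\<^sup>2 * ((x ! 2 - a)\<^sup>2 + (x ! 3 - b)\<^sup>2) = d\<^sup>2 \<and>
      p1 = x ! 2 + t * (x ! 2 - a) \<and> p2 = x ! 3 + t * (x ! 3 - b)" if "x \<in> Y" for x
  proof -
    have "x \<in> B" using that Y by blast
    then obtain y1 y2 t where y: "x = cover_point a b d (y1, y2, t)" "eval2 f y1 y2 = 0"
      "t\<^sup>2 * ((y1 - a)\<^sup>2 + (y2 - b)\<^sup>2) = d\<^sup>2" by (rule BE)
    moreover have "pi1 x = [p1, p2]" using const that by blast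
    ultimately show ?thesis
      by (intro exI[of _ t]) (simp add: pi1_def cover_point_def numeral_eq_Suc)
  qed
  have infinite_base: "infinite S" if "\<And>x. x \<in> Y \<Longrightarrow> (x ! 2, x ! 3) \<in> S" for S
  proof
    assume "finite S"
    then have "finite {x \<in> B. (x ! 2, x ! 3) \<in> S}" by (rule finite_cover_over)
    moreover have "Y \<subseteq> {x \<in> B. (x ! 2, x ! 3) \<in> S}" using Y that by blast
    ultimately show False using Y(2) finite_subset by blast
  qed
  have "p1 = a \<and> p2 = b"
  proof (rule ccontr)
    assume neq: "\<not> ?thesis"
    let ?S = "(\<lambda>s. (p1 + s * (p1 - a), p2 + s * (p2 - b))) `
      {s. s\<^sup>2 * ((p1 - a)\<^sup>2 + (p2 - b)\<^sup>2) = d\<^sup>2}"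
    have "finite ?S" using finite_square_solutions[of "d\<^sup>2"] d_nonzero by simp
    moreover have "(x ! 2, x ! 3) \<in> ?S" if x: "x \<in> Y" for x
    proof -
      obtain t where t: "t\<^sup>2 * ((x ! 2 - a)\<^sup>2 + (x ! 3 - b)\<^sup>2) = d\<^sup>2"
        "p1 = x ! 2 + t * (x ! 2 - a)" "p2 = x ! 3 + t * (x ! 3 - b)" using coords[OF x] by blast
      have "t \<noteq> - 1"
      proof
        assume "t = - 1"
        with t(2,3) neq show False by simp
      qed
      from conchoid_inverse[OF t(1) this t(2,3)] obtain s where
        "s\<^sup>2 * ((p1 - a)\<^sup>2 + (p2 - b)\<^sup>2) = d\<^sup>2"
        "x ! 2 = p1 + s * (p1 - a)" "x ! 3 = p2 + s * (p2 - b)" .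
      then show ?thesis by blast
    qed
    ultimately show False using infinite_base by blast
  qed
  then have p: "p1 = a" "p2 = b" by simp_all
  let ?Z = "{(y1, y2). (y1 - a)\<^sup>2 + (y2 - b)\<^sup>2 = d\<^sup>2 \<and> eval2 f y1 y2 = 0}"
  have "(x ! 2, x ! 3) \<in> ?Z" if x: "x \<in> Y" for x
  proof -
    obtain t where t: "eval2 f (x ! 2) (x ! 3) = 0"
      "t\<^sup>2 * ((x ! 2 - a)\<^sup>2 + (x ! 3 - b)\<^sup>2) = d\<^sup>2"
      "a = x ! 2 + t * (x ! 2 - a)" "b = x ! 3 + t * (x ! 3 - b)" using coords[OF x] unfolding p by blast
    have "(1 + t) * (x ! 2 - a) = (x ! 2 + t * (x ! 2 - a)) - a"
      "(1 + t) * (x ! 3 - b) = (x ! 3 + t * (x ! 3 - b)) - b" by (simp_all add: algebra_simps)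
    then have "(1 + t) * (x ! 2 - a) = 0" "(1 + t) * (x ! 3 - b) = 0"
      unfolding t(3,4)[symmetric] by simp_all
    moreover have "x ! 2 - a \<noteq> 0 \<or> x ! 3 - b \<noteq> 0" using t(2) d_nonzero by auto
    ultimately have "t = - 1" by (metis add.commute add_eq_0_iff mult_eq_0_iff)
    then show ?thesis using t(1,2) by simp
  qed
  then have inf: "infinite ?Z" by (rule infinite_base)
  let ?k = "dist2_poly a b - [:[:d\<^sup>2:]:]"
  have "f dvd ?k"
  proof (rule ccontr)
    assume "\<not> f dvd ?k"
    from finite_common_zeros[OF alg_closed irreducible this] have "finite ?Z"
      by (rule rev_finite_subset) auto
    then show False using inf by contradiction
  qed
  then have "(y1 - a)\<^sup>2 + (y2 - b)\<^sup>2 = d\<^sup>2" if "eval2 f y1 y2 = 0" for y1 y2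
    using eval2_dvd_zero[OF _ that, of ?k] by simp
  \<comment> \<open>Divisibility only places the curve inside the circle; the reverse inclusion uses
    the parametrisation of the circle.\<close>
  moreover have "eval2 f y1 y2 = 0" if "(y1 - a)\<^sup>2 + (y2 - b)\<^sup>2 = d\<^sup>2" for y1 y2
    using vanish_on_circle[OF alg_closed d_nonzero inf that] .
  ultimately show ?thesis unfolding curve_def circle_def by blast
qed

text \<open>On this circle the squared distance to A is d^2, so t is 1 or -1: the first doubles y -
  A, the second collapses everything to A. The projection is already closed.\<close>

lemma circle_conchoid:
  assumes "curve f = circle a b d"
  shows "conchoid f a b d = {[a, b]} \<union> circle a b (2 * d)"
proof -
  have f: "eval2 f y1 y2 = 0 \<longleftrightarrow> (y1 - a)\<^sup>2 + (y2 - b)\<^sup>2 = d\<^sup>2" for y1 y2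
  proof -
    have "[y1, y2] \<in> curve f \<longleftrightarrow> [y1, y2] \<in> circle a b d" using assms by simp
    then show ?thesis by (simp add: curve_def circle_def)
  qed
  have "pi1 ` B = {[a, b]} \<union> circle a b (2 * d)"
  proof (intro subset_antisym subsetI)
    fix z assume "z \<in> pi1 ` B"
    then obtain x where x: "x \<in> B" "z = pi1 x" by blast
    obtain y1 y2 t where y: "x = cover_point a b d (y1, y2, t)" "eval2 f y1 y2 = 0"
      "t\<^sup>2 * ((y1 - a)\<^sup>2 + (y2 - b)\<^sup>2) = d\<^sup>2" using BE[OF x(1)] .
    have "t\<^sup>2 = 1" using y(2,3) d_nonzero by (simp add: f)
    then consider "t = 1" | "t = - 1" by (auto simp: power2_eq_1_iff)
    then show "z \<in> {[a, b]} \<union> circle a b (2 * d)"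
    proof cases
      case 1
      then have z: "z = [y1 + (y1 - a), y2 + (y2 - b)]" by (simp add: x y(1) pi1_def cover_point_def)
      have "(y1 + (y1 - a) - a)\<^sup>2 + (y2 + (y2 - b) - b)\<^sup>2 = 4 * ((y1 - a)\<^sup>2 + (y2 - b)\<^sup>2)"
        by (simp add: power2_eq_square algebra_simps)
      also have "\<dots> = (2 * d)\<^sup>2" using y(2) by (simp add: f)
      finally show ?thesis unfolding z circle_def by blast
    next
      case 2
      then show ?thesis by (simp add: x y(1) pi1_def cover_point_def)
    qed
  next
    fix z assume "z \<in> {[a, b]} \<union> circle a b (2 * d)"
    then consider "z = [a, b]" | x1 x2 where "z = [x1, x2]" "(x1 - a)\<^sup>2 + (x2 - b)\<^sup>2 = (2 * d)\<^sup>2"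
      unfolding circle_def by blast
    then show "z \<in> pi1 ` B"
    proof cases
      case 1
      have "cover_point a b d (a + d, b, - 1) \<in> B" unfolding B_cover by (auto simp: f)
      then show ?thesis by (rule rev_image_eqI) (simp add: 1 pi1_def cover_point_def)
    next
      case (2 x1 x2)
      define p q where "p = (x1 - a) / 2" and "q = (x2 - b) / 2"
      have pq: "x1 = a + 2 * p" "x2 = b + 2 * q" 
        unfolding p_def q_def by (simp_all del: right_diff_distrib_numeral)
      have "4 * (p\<^sup>2 + q\<^sup>2) = 4 * d\<^sup>2"
        using 2(2) unfolding pq by (simp add: power2_eq_square algebra_simps)
      then have "p\<^sup>2 + q\<^sup>2 = d\<^sup>2" by (subst (asm) mult_cancel_left) simp
      then have "cover_point a b d (a + p, b + q, 1) \<in> B" unfolding B_cover by (auto simp: f)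
      then show ?thesis by (rule rev_image_eqI) (simp add: 2(1) pq pi1_def cover_point_def)
    qed
  qed
  moreover have "zclosed 2 ({[a, b]} \<union> circle a b (2 * d))"
  proof (rule zclosed_Un)
    show "zclosed 2 {[a, b]}" by (rule zclosed_singleton) simp
    show "zclosed 2 (circle a b (2 * d))"
    proof (rule zclosedI)
      let ?S = "{\<lambda>x. (x ! 0 - a)\<^sup>2 + (x ! 1 - b)\<^sup>2 - (2 * d)\<^sup>2}"
      show "?S \<subseteq> poly_fun 2"
        unfolding insert_subset
        by (intro conjI empty_subsetI poly_fun_diff poly_fun_power poly_fun.add
            poly_fun.const poly_fun.var) simp_all
      show "circle a b (2 * d) = zero_set 2 ?S"
        by (auto simp: circle_def in_zero_set numeral_eq_Suc length_Suc_conv)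
    qed
  qed
  ultimately show ?thesis by (simp add: conchoid_def zclosure_eq)
qed

section \<open>Dimensions of the components and the theorem\<close>

lemma zdim_curve_in_B:
  assumes "zirreducible 5 Z" "infinite Z" "Z \<subseteq> B"
  shows "zdim 5 Z = 1"
  using assms(1,2)
proof (rule zdim_eq_1I)
  fix W Y assume "zirreducible 5 W" "W \<subseteq> Z" "zclosed 5 Y" "Y \<subset> W"
  then show "finite Y" using finite_proper_closed_subset[of W Y] assms(3) by blast
qed

text \<open>A finite closure would be a single point, which
  \<open>projection_constant_imp_circle\<close> excludes; the polynomial from
  \<open>vanishing_on_projection\<close> brings in the finiteness of proper closed subsets in the
  plane.\<close>

lemma zdim_projection:
  assumes Y: "zirreducible 5 Y" "infinite Y" "Y \<subseteq> B" and ne: "curve f \<noteq> circle a b d"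
  shows "zdim 2 (zclosure 2 (pi1 ` Y)) = 1"
proof (rule zdim_eq_1I)
  let ?U = "zclosure 2 (pi1 ` Y)"
  show irr: "zirreducible 2 ?U"
    using Y(1) by (rule zirreducible_zclosure_image) (simp_all add: pi1_poly_fun)
  show "infinite ?U"
  proof
    assume "finite ?U"
    then obtain p where p: "?U = {p}" using zirreducible_finite irr by blast
    then have "length p = 2" using zclosed_length[OF zirreducible_closed[OF irr]] by blast
    then obtain p1 p2 where "p = [p1, p2]" by (auto simp: numeral_eq_Suc length_Suc_conv)
    then have "pi1 ` Y \<subseteq> {[p1, p2]}" using zclosure_subset[of "pi1 ` Y" 2] p by simp
    then show False using projection_constant_imp_circle Y ne by blast
  qed
  obtain h where h: "h \<noteq> 0" "\<forall>x\<in>B. eval2 h (x ! 0) (x ! 1) = 0"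
    by (rule vanishing_on_projection)
  let ?V = "{x \<in> affine_space 2. eval2 h (x ! 0) (x ! 1) = 0}"
  have "zclosed 2 ?V" by (intro zclosed_vanishing eval2_poly_fun poly_fun.var) simp_all
  moreover have "pi1 ` Y \<subseteq> ?V"
    using h(2) Y(3) by (auto simp: pi1_def affine_space_def)
  ultimately have U: "?U \<subseteq> ?V" by (rule zclosure_least)
  fix W X assume W: "zirreducible 2 W" "W \<subseteq> ?U" and X: "zclosed 2 X" "X \<subset> W"
  have "eval2 h y1 y2 = 0" if "[y1, y2] \<in> W" for y1 y2
    using subsetD[OF U, of "[y1, y2]"] W(2) that by auto
  then show "finite X"
    using finite_proper_closed_subset_plane[OF alg_closed h(1) _ W(1) X] by blast
qed

end

theorem theorem1:
  fixes f :: "'a::field_char_0 poly poly" and a b d :: 'a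
  assumes "alg_closed TYPE('a)"
    and "irreducible f"
    and "d \<noteq> 0"
    and "C0 f a b \<noteq> {}"
  shows "(\<forall>Z \<in> irr_components 5 (Bset f a b d). zdim 5 Z = 1)
    \<and> (curve f \<noteq> circle a b d \<longrightarrow>
         (\<forall>Z \<in> irr_components 2 (conchoid f a b d). zdim 2 Z = 1))
    \<and> (curve f = circle a b d \<longrightarrow>
         conchoid f a b d = {[a, b]} \<union> circle a b (2 * d))
    \<and> finite (irr_components 2 (conchoid f a b d))
    \<and> card (irr_components 2 (conchoid f a b d)) \<le> 2"
proof -
  interpret conchoid_setup f a b d
    using assms by unfold_locales
  obtain Y where Y: "zirreducible 5 Y" "infinite Y" "Y \<union> flip ` Y = B"
    by (rule irreducible_half)
  have Y_aff: "Y \<subseteq> affine_space 5" by (rule zclosed_subset_affine[OF zirreducible_closed[OF Y(1)]])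
  have flipY: "zirreducible 5 (flip ` Y)" using Y(1) by (rule zirreducible_flip)
  have inf: "infinite (flip ` Y)"
  proof
    assume "finite (flip ` Y)"
    then have "finite (flip ` flip ` Y)" by (rule finite_imageI)
    then show False using flip_image_image[OF Y_aff] Y(2) by simp
  qed
  have sub: "Y \<subseteq> B" "flip ` Y \<subseteq> B" using Y(3) by blast+
  let ?U = "zclosure 2 (pi1 ` Y)" and ?V = "zclosure 2 (pi1 ` flip ` Y)"
  have irr: "zirreducible 2 ?U" "zirreducible 2 ?V"
    using Y(1) flipY by (auto intro: zirreducible_zclosure_image pi1_poly_fun)
  \<comment> \<open>The two pieces coincide when Y is all of B, so this yields a bound on the number
    of components and not an exact count.\<close>
  have "conchoid f a b d = ?U \<union> ?V"
    unfolding conchoid_def Y(3)[symmetric] image_Un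
    by (rule zclosure_Un) (auto simp: affine_space_def)
  then have comps: "irr_components 2 (conchoid f a b d) \<subseteq> {?U, ?V}"
    using irr_components_Un[OF irr] by simp
  have "zdim 5 Z = 1" if "Z \<in> irr_components 5 (Bset f a b d)" for Z
  proof -
    have "Z = Y \<or> Z = flip ` Y" using irr_components_Un[OF Y(1) flipY] that Y(3) by auto
    then show ?thesis using zdim_curve_in_B Y(1,2) flipY inf sub by blast
  qed
  moreover have "zdim 2 Z = 1"
    if "curve f \<noteq> circle a b d" "Z \<in> irr_components 2 (conchoid f a b d)" for Z
  proof -
    have "Z = ?U \<or> Z = ?V" using comps that(2) by blast
    then show ?thesis using zdim_projection Y(1,2) flipY inf sub that(1) by blast
  qed
  moreover have "finite (irr_components 2 (conchoid f a b d))"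
    using comps by (rule finite_subset) simp
  moreover have "card (irr_components 2 (conchoid f a b d)) \<le> 2"
    using card_mono[OF _ comps] card_insert_le_m1[of 2 "{?V}" ?U]
    by (simp add: card_insert_if split: if_splits)
  ultimately show ?thesis using circle_conchoid by blast
qed

end
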